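(* Let $\phi\in\{\phi_{sq},\phi_{svm},\phi_{KL}\}$. For any sequence of instances and labels $(X_t,R_t)_{t\in[T]}$, applying algorithm RTop-$k$F (described in the context) with surrogate $\phi$ and its associated gradient estimator $\tilde z_t$, with top-$1$ feedback ($k=1$) for $\phi_{sq}$ and $\phi_{KL}$ and top-$2$ feedback ($k=2$) for $\phi_{svm}$, and with parameters $\eta=O(T^{-2/3})$ and $\gamma=O(T^{-1/3})$ (the choices obtained by optimizing the bound over $\eta$ and $\gamma$), produces the following bound on the regret: $$\mathbb{E}\Big[\sum_{t=1}^T \phi(\tilde s_t,R_t)\Big]-\min_{w:\ \|w\|_2\le U}\ \sum_{t=1}^T\phi(X_tw,R_t)\ \le\ C^{\phi}\,O\big(T^{2/3}\big).$$ Here $C^{\phi}\in\{C^{sq},C^{svm},C^{KL}\}$ is a surrogate-dependent polynomial function of $R_D, m, U, R_{\max}$, where the degree of the polynomial depends on the surrogate and is never greater than four, and the expectation is over the underlying randomness of the algorithm over the $T$ rounds.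
   Context: Setting. There are $m$ documents per round. $X_t\in\mathbb{R}^{m\times d}$ is a document matrix whose rows have $\ell_2$ norm at most $R_D$; $R_t\in\{0,1,\dots,n\}^m$ is a relevance vector, and $R_{\max}$ is the maximum possible relevance value. The sequence $(X_t,R_t)$ is generated by an oblivious adversary. $U$ is the radius of the Euclidean ball of ranking parameters $w\in\mathbb{R}^d$. For a score vector $s\in\mathbb{R}^m$, $\mathrm{argsort}(s)\in S_m$ is the permutation of $\{1,\dots,m\}$ obtained by sorting $s$ in descending order; for a permutation $\sigma$, $\sigma(i)$ is the document placed at rank $i$. $e_i$ is the $i$th standard basis vector of $\mathbb{R}^m$. Surrogates: - $\phi_{sq}(s,R)=\|s-R\|_2^2$; - $\phi_{svm}(s,R)=\sum_{i\ne j}\mathbb{1}(R_i>R_j)\max(0,1+s_j-s_i)$; - $\phi_{KL}(s,R)=\sum_{i=1}^m e^{R_i}R_i-\sum_{i=1}^m e^{R_i}s_i-\sum_{i=1}^m e^{R_i}+\sum_{i=1}^m e^{s_i}$. Algorithm RTop-$k$F with exploration parameter $\gamma\in(0,1/2)$ and learning rate $\eta>0$: start with $w_1=0\in\mathbb{R}^d$. At round $t=1,\dots,T$: receive $X_t$; let $s_t=X_tw_t$ and $\sigma_t=\mathrm{argsort}(s_t)$; with probability $1-\gamma$ set $\tilde s_t=s_t$ and with probability $\gamma$ draw $\tilde s_t$ uniformly from $[0,1]^m$; output $\tilde\sigma_t=\mathrm{argsort}(\tilde s_t)$ (so $\tilde\sigma_t$ has distribution $\mathbb{P}_t(\sigma)=(1-\gamma)\mathbb{1}(\sigma=\sigma_t)+\gamma/m!$);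 observe only $R_{t,\tilde\sigma_t(1)},\dots,R_{t,\tilde\sigma_t(k)}$; suffer the (unobserved) loss $\phi(\tilde s_t,R_t)$; compute the estimator $\tilde z_t$ below; set $w=w_t-\eta\tilde z_t$ and $w_{t+1}=\min\{1,U/\|w\|_2\}\,w$. Estimators. Write $s=s_t$, $\sigma=\tilde\sigma_t$, $X=X_t$, $R=R_t$, $p(i)=\mathbb{P}_t(\pi(1)=i)$ and $p(i,j)=\mathbb{P}_t(\pi(1)=i,\pi(2)=j)$ for $\pi\sim\mathbb{P}_t$. - For $\phi_{sq}$: $\tilde z_t=X^\top\Big(2\big(s-\frac{R_{\sigma(1)}e_{\sigma(1)}}{p(\sigma(1))}\big)\Big)$. - For $\phi_{svm}$: $\tilde z_t=X^\top\Big(\frac{h_{\sigma(1),\sigma(2)}+h_{\sigma(2),\sigma(1)}}{p(\sigma(1),\sigma(2))+p(\sigma(2),\sigma(1))}\Big)$, where $h_{i,j}=\mathbb{1}(R_i>R_j)\mathbb{1}(1+s_j>s_i)(e_j-e_i)$. - For $\phi_{KL}$: $\tilde z_t=X^\top\Big(\frac{(e^{s_{\sigma(1)}}-e^{R_{\sigma(1)}})e_{\sigma(1)}}{p(\sigma(1))}\Big)$.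
   Formalization: For φ_KL the bound carries an extra factor exp(max(R_max, R_D·U)) besides the polynomial C^KL of degree at most four, since no polynomial in R_D, m, U, R_max times an absolute O(T^{2/3}) can bound the regret (e.g. m=d=1, X=1, U=R=n). *)

theory Defs
  imports
    "HOL-Probability.Probability"
    "HOL-Combinatorics.Multiset_Permutations"
    "HOL-Library.Landau_Symbols"
begin

text \<open>
  The numbers \<open>m\<close> of documents and \<open>d\<close> of features are natural-number variables (the constants in
  the regret bound must not depend on \<open>d\<close>, and must depend on \<open>m\<close> polynomially). Hence vectors in
  \<open>\<real>\<^sup>m\<close> and \<open>\<real>\<^sup>d\<close> are functions \<open>nat \<Rightarrow> real\<close> of which only the values on \<open>{..<m}\<close> resp. \<open>{..<d}\<close>
  matter, and their Euclidean norms are \<open>L2_set _ {..<m}\<close> resp. \<open>L2_set _ {..<d}\<close>. Documents,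
  ranks, features and rounds are numbered from 0.
\<close>

datatype surrogate = SQ | SVM | KL

definition score :: "nat \<Rightarrow> (nat \<Rightarrow> nat \<Rightarrow> real) \<Rightarrow> (nat \<Rightarrow> real) \<Rightarrow> nat \<Rightarrow> real" where
  "score d X w = (\<lambda>i. \<Sum>j<d. X i j * w j)"

text \<open>Multiplication with the transpose of \<open>X\<close>.\<close>

definition backproj :: "nat \<Rightarrow> (nat \<Rightarrow> nat \<Rightarrow> real) \<Rightarrow> (nat \<Rightarrow> real) \<Rightarrow> nat \<Rightarrow> real" where
  "backproj m X v = (\<lambda>j. \<Sum>i<m. X i j * v i)"

definition basis_vec :: "nat \<Rightarrow> nat \<Rightarrow> real" where
  "basis_vec i = (\<lambda>l. of_bool (l = i))"

definition loss :: "surrogate \<Rightarrow> nat \<Rightarrow> (nat \<Rightarrow> real) \<Rightarrow> (nat \<Rightarrow> nat) \<Rightarrow> real" where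
  "loss \<phi> m s R = (case \<phi> of
     SQ \<Rightarrow> (L2_set (\<lambda>i. s i - real (R i)) {..<m})\<^sup>2
   | SVM \<Rightarrow> (\<Sum>i<m. \<Sum>j\<in>{..<m} - {i}. of_bool (R i > R j) * max 0 (1 + s j - s i))
   | KL \<Rightarrow> (\<Sum>i<m. exp (real (R i)) * real (R i)) - (\<Sum>i<m. exp (real (R i)) * s i)
            - (\<Sum>i<m. exp (real (R i))) + (\<Sum>i<m. exp (s i)))"

text \<open>
  A ranking is the list of the documents from the top rank downwards, that is, an element of
  \<open>permutations_of_set {..<m}\<close>. \<open>sort_key\<close> is stable, so ties are broken in favour of the smaller
  document index.
\<close>

definition argsort :: "nat \<Rightarrow> (nat \<Rightarrow> real) \<Rightarrow> nat list" where
  "argsort m s = sort_key (\<lambda>i. - s i) [0..<m]"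

definition ranking_prob :: "nat \<Rightarrow> real \<Rightarrow> nat list \<Rightarrow> nat list \<Rightarrow> real" where
  "ranking_prob m \<gamma> \<sigma>\<^sub>t \<sigma> = (1 - \<gamma>) * of_bool (\<sigma> = \<sigma>\<^sub>t) + \<gamma> / fact m"

definition top1_prob :: "nat \<Rightarrow> real \<Rightarrow> nat list \<Rightarrow> nat \<Rightarrow> real" where
  "top1_prob m \<gamma> \<sigma>\<^sub>t i =
     (\<Sum>\<pi>\<in>{\<pi> \<in> permutations_of_set {..<m}. \<pi> ! 0 = i}. ranking_prob m \<gamma> \<sigma>\<^sub>t \<pi>)"

definition top2_prob :: "nat \<Rightarrow> real \<Rightarrow> nat list \<Rightarrow> nat \<Rightarrow> nat \<Rightarrow> real" where
  "top2_prob m \<gamma> \<sigma>\<^sub>t i j =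
     (\<Sum>\<pi>\<in>{\<pi> \<in> permutations_of_set {..<m}. \<pi> ! 0 = i \<and> \<pi> ! 1 = j}. ranking_prob m \<gamma> \<sigma>\<^sub>t \<pi>)"

fun feedback_size :: "surrogate \<Rightarrow> nat" where
  "feedback_size SQ = 1"
| "feedback_size SVM = 2"
| "feedback_size KL = 1"

definition feedback :: "nat \<Rightarrow> nat list \<Rightarrow> (nat \<Rightarrow> nat) \<Rightarrow> nat list" where
  "feedback k \<sigma> R = map R (take k \<sigma>)"

text \<open>
  \<open>hinge_dir s i r j r'\<close> is the vector \<open>h\<^bsub>i,j\<^esub>\<close> for documents \<open>i\<close>, \<open>j\<close> of relevance \<open>r\<close>, \<open>r'\<close>.
\<close>

definition hinge_dir :: "(nat \<Rightarrow> real) \<Rightarrow> nat \<Rightarrow> nat \<Rightarrow> nat \<Rightarrow> nat \<Rightarrow> nat \<Rightarrow> real" where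
  "hinge_dir s i r j r' =
     (\<lambda>l. of_bool (r > r') * of_bool (1 + s j > s i) * (basis_vec j l - basis_vec i l))"

text \<open>
  The gradient estimator sees the relevance vector only through the observed list \<open>fb\<close>, whose
  entries are the relevances of the documents \<open>\<sigma> ! 0\<close>, \<open>\<sigma> ! 1\<close>, etc.
\<close>

definition estimator ::
    "surrogate \<Rightarrow> nat \<Rightarrow> real \<Rightarrow> (nat \<Rightarrow> nat \<Rightarrow> real) \<Rightarrow> (nat \<Rightarrow> real) \<Rightarrow> nat list \<Rightarrow> nat list \<Rightarrow> nat \<Rightarrow> real"
  where
  "estimator \<phi> m \<gamma> X s \<sigma> fb =
     (let p1 = top1_prob m \<gamma> (argsort m s); p2 = top2_prob m \<gamma> (argsort m s) in
      backproj m X (case \<phi> of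
        SQ \<Rightarrow> (\<lambda>l. 2 * (s l - real (fb ! 0) * basis_vec (\<sigma> ! 0) l / p1 (\<sigma> ! 0)))
      | SVM \<Rightarrow> (\<lambda>l. (hinge_dir s (\<sigma> ! 0) (fb ! 0) (\<sigma> ! 1) (fb ! 1) l
                    + hinge_dir s (\<sigma> ! 1) (fb ! 1) (\<sigma> ! 0) (fb ! 0) l)
                   / (p2 (\<sigma> ! 0) (\<sigma> ! 1) + p2 (\<sigma> ! 1) (\<sigma> ! 0)))
      | KL \<Rightarrow> (\<lambda>l. (exp (s (\<sigma> ! 0)) - exp (real (fb ! 0))) * basis_vec (\<sigma> ! 0) l / p1 (\<sigma> ! 0))))"

definition project :: "nat \<Rightarrow> real \<Rightarrow> (nat \<Rightarrow> real) \<Rightarrow> nat \<Rightarrow> real" where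
  "project d U w = (\<lambda>j. min 1 (U / L2_set w {..<d}) * w j)"

text \<open>
  The randomness of one round: a coin that decides whether to explore, and an independent uniform
  score vector. The rounds are independent.
\<close>

type_synonym noise = "bool \<times> (nat \<Rightarrow> real)"

definition round_noise :: "nat \<Rightarrow> real \<Rightarrow> noise measure" where
  "round_noise m \<gamma> =
     measure_pmf (bernoulli_pmf \<gamma>) \<Otimes>\<^sub>M (\<Pi>\<^sub>M i\<in>{..<m}. uniform_measure lborel {0..1})"

definition run_noise :: "nat \<Rightarrow> nat \<Rightarrow> real \<Rightarrow> (nat \<Rightarrow> noise) measure" where
  "run_noise T m \<gamma> = (\<Pi>\<^sub>M t\<in>{..<T}. round_noise m \<gamma>)"

definition played_score :: "(nat \<Rightarrow> real) \<Rightarrow> noise \<Rightarrow> nat \<Rightarrow> real" where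
  "played_score s \<xi> = (if fst \<xi> then snd \<xi> else s)"

text \<open>The parameter vector at the beginning of round \<open>t\<close> of RTop-$k$F, for the noise \<open>\<omega>\<close>.\<close>

primrec rtop_weight ::
    "surrogate \<Rightarrow> nat \<Rightarrow> nat \<Rightarrow> real \<Rightarrow> real \<Rightarrow> real \<Rightarrow> (nat \<Rightarrow> nat \<Rightarrow> nat \<Rightarrow> real) \<Rightarrow> (nat \<Rightarrow> nat \<Rightarrow> nat)
     \<Rightarrow> (nat \<Rightarrow> noise) \<Rightarrow> nat \<Rightarrow> nat \<Rightarrow> real"
  where
  "rtop_weight \<phi> m d U \<eta> \<gamma> X R \<omega> 0 = (\<lambda>_. 0)"
| "rtop_weight \<phi> m d U \<eta> \<gamma> X R \<omega> (Suc t) =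
     (let w = rtop_weight \<phi> m d U \<eta> \<gamma> X R \<omega> t;
          s = score d (X t) w;
          \<sigma> = argsort m (played_score s (\<omega> t));
          z = estimator \<phi> m \<gamma> (X t) s \<sigma> (feedback (feedback_size \<phi>) \<sigma> (R t))
      in project d U (\<lambda>j. w j - \<eta> * z j))"

definition rtop_loss ::
    "surrogate \<Rightarrow> nat \<Rightarrow> nat \<Rightarrow> real \<Rightarrow> real \<Rightarrow> real \<Rightarrow> (nat \<Rightarrow> nat \<Rightarrow> nat \<Rightarrow> real) \<Rightarrow> (nat \<Rightarrow> nat \<Rightarrow> nat)
     \<Rightarrow> nat \<Rightarrow> (nat \<Rightarrow> noise) \<Rightarrow> real"
  where
  "rtop_loss \<phi> m d U \<eta> \<gamma> X R T \<omega> =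
     (\<Sum>t<T. loss \<phi> m (played_score (score d (X t) (rtop_weight \<phi> m d U \<eta> \<gamma> X R \<omega> t)) (\<omega> t)) (R t))"

definition comparator_loss ::
    "surrogate \<Rightarrow> nat \<Rightarrow> nat \<Rightarrow> (nat \<Rightarrow> nat \<Rightarrow> nat \<Rightarrow> real) \<Rightarrow> (nat \<Rightarrow> nat \<Rightarrow> nat) \<Rightarrow> nat
     \<Rightarrow> (nat \<Rightarrow> real) \<Rightarrow> real"
  where
  "comparator_loss \<phi> m d X R T w = (\<Sum>t<T. loss \<phi> m (score d (X t) w) (R t))"

definition regret ::
    "surrogate \<Rightarrow> nat \<Rightarrow> nat \<Rightarrow> real \<Rightarrow> real \<Rightarrow> real \<Rightarrow> (nat \<Rightarrow> nat \<Rightarrow> nat \<Rightarrow> real) \<Rightarrow> (nat \<Rightarrow> nat \<Rightarrow> nat)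
     \<Rightarrow> nat \<Rightarrow> real"
  where
  "regret \<phi> m d U \<eta> \<gamma> X R T =
     (\<integral>\<omega>. rtop_loss \<phi> m d U \<eta> \<gamma> X R T \<omega> \<partial>run_noise T m \<gamma>)
     - (INF w\<in>{w. L2_set w {..<d} \<le> U}. comparator_loss \<phi> m d X R T w)"

text \<open>A real polynomial of total degree at most \<open>D\<close> in four variables, with coefficients \<open>c\<close>.\<close>

definition poly4 ::
    "nat \<Rightarrow> (nat \<Rightarrow> nat \<Rightarrow> nat \<Rightarrow> nat \<Rightarrow> real) \<Rightarrow> real \<Rightarrow> real \<Rightarrow> real \<Rightarrow> real \<Rightarrow> real" where
  "poly4 D c x y u v =
     (\<Sum>i\<le>D. \<Sum>j\<le>D - i. \<Sum>k\<le>D - i - j. \<Sum>l\<le>D - i - j - k. c i j k l * x ^ i * y ^ j * u ^ k * v ^ l)"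

text \<open>
  The part of the constant hidden in \<open>O(T\<^bsup>2/3\<^esup>)\<close> that depends on the instance. For the squared and
  the SVM surrogate there is none. The KL surrogate and its gradient contain the exponentials of the
  relevances, which range up to \<open>Rmax\<close>, and of the scores, which range up to \<open>RD * U\<close>; no
  polynomial in these quantities dominates them, so the largest such exponential is a factor of the
  hidden constant.
\<close>

fun hidden_factor :: "surrogate \<Rightarrow> real \<Rightarrow> real \<Rightarrow> real \<Rightarrow> real" where
  "hidden_factor SQ RD U Rmax = 1"
| "hidden_factor SVM RD U Rmax = 1"
| "hidden_factor KL RD U Rmax = exp (max Rmax (RD * U))"

definition admissible ::
    "nat \<Rightarrow> nat \<Rightarrow> nat \<Rightarrow> real \<Rightarrow> nat \<Rightarrow> (nat \<Rightarrow> nat \<Rightarrow> nat \<Rightarrow> real) \<Rightarrow> (nat \<Rightarrow> nat \<Rightarrow> nat) \<Rightarrow> bool" where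
  "admissible m d n RD T X R \<longleftrightarrow>
     (\<forall>t<T. \<forall>i<m. L2_set (X t i) {..<d} \<le> RD \<and> R t i \<le> n)"

end

(*
  Write s for the score vector of round t. The estimator z is unbiased for a subgradient of the
  surrogate in w, and E|z|^2 <= A * loss(s) + B / gamma, where A is nonzero only for the squared
  surrogate: there the non-exploratory part of z is controlled by the loss itself. Following the
  potential E|w_t - v|^2 through projected gradient descent gives
    (1 - eta A / 2) sum E loss(s_t) <= sum loss(X_t v) + |v|^2 / (2 eta) + eta T B / (2 gamma),
  and exploration costs at most gamma T times the loss of scores in [0, 1].

  Only the squared surrogate needs care to reach degree four. The self-bounding term avoids the
  variance contribution m^2 RD^4 U^2; when eta A > 1, which happens only for small T, the learning
  rate is taken tiny instead, and comparison with the initial weight v = 0 bounds the regret by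
  2 T m n^2 plus lower-order terms, which is small enough for such T.
*)

theory Submission
  imports Defs
begin

section \<open>Vectors\<close>

text \<open>\<open>c\<close> and \<open>g\<close> are fixed before the instance, so the bound must
  hold at every T > 0 and no lower-order term may be absorbed by taking T large. Hence the degree of
  every term counts, even of those that vanish against T^(2/3); this is what makes the squared
  surrogate delicate. Minimizing U^2 / \<eta> + \<eta> T B / \<gamma> with \<gamma> of order
  T^(-1/3) suggests \<eta> = U / (sqrt B * T^(2/3)). Up to constants sqrt B is m RD n, m^2 RD or m
  RD times an exponential; \<open>tuned_regret\<close> replaces the factors RD and n by RD + 1 and n
  + 1, so that the quotient makes sense when they are 0. The probabilistic obstacle is that the
  weights depend on past continuous noise. They do so only through the coins and the explored
  rankings, which take finitely many values, so conditioning on the past becomes a finite case split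
  followed by Fubini in one coordinate.\<close>

lemma L2_set_power2: "(L2_set v A)\<^sup>2 = (\<Sum>i\<in>A. (v i)\<^sup>2)"
  by (simp add: L2_set_def sum_nonneg)

lemma sum_mult_le_L2_set: "\<bar>\<Sum>i\<in>A. v i * w i\<bar> \<le> L2_set v A * L2_set w A"
proof -
  have "\<bar>\<Sum>i\<in>A. v i * w i\<bar> \<le> (\<Sum>i\<in>A. \<bar>v i\<bar> * \<bar>w i\<bar>)"
    using sum_abs[of "\<lambda>i. v i * w i" A] by (simp add: abs_mult)
  with L2_set_mult_ineq show ?thesis by (rule order_trans[rotated])
qed

lemma L2_set_sum_le: "finite I \<Longrightarrow> L2_set (\<lambda>j. \<Sum>i\<in>I. v i j) A \<le> (\<Sum>i\<in>I. L2_set (v i) A)"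
proof (induction I rule: finite_induct)
  case empty
  then show ?case by (simp add: L2_set_def)
next
  case (insert i I)
  then show ?case
    using L2_set_triangle_ineq[of "v i" "\<lambda>j. \<Sum>i\<in>I. v i j" A] by simp
qed

lemma L2_set_scale: "L2_set (\<lambda>j. c * v j) A = \<bar>c\<bar> * L2_set v A"
  by (simp add: L2_set_def power_mult_distrib sum_distrib_left[symmetric] real_sqrt_mult)

lemma abs_score_le:
  assumes "L2_set (X i) {..<d} \<le> RD"
  shows "\<bar>score d X w i\<bar> \<le> RD * L2_set w {..<d}"
proof -
  have "\<bar>score d X w i\<bar> \<le> L2_set (X i) {..<d} * L2_set w {..<d}"
    unfolding score_def by (rule sum_mult_le_L2_set)
  also have "\<dots> \<le> RD * L2_set w {..<d}"
    using assms by (simp add: mult_right_mono)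
  finally show ?thesis .
qed

text \<open>\<open>backproj m X v\<close> combines the rows of \<open>X\<close> with weights
  \<open>v\<close>, so the triangle inequality yields the l1 norm of \<open>v\<close>. This suits
  the SVM and KL estimators, which are supported on at most two documents.\<close>

lemma L2_set_backproj_le:
  assumes "\<And>i. i < m \<Longrightarrow> L2_set (X i) {..<d} \<le> RD"
  shows "L2_set (backproj m X v) {..<d} \<le> RD * (\<Sum>i<m. \<bar>v i\<bar>)"
proof -
  have "L2_set (backproj m X v) {..<d} \<le> (\<Sum>i<m. L2_set (\<lambda>j. v i * X i j) {..<d})"
    unfolding backproj_def using L2_set_sum_le[of "{..<m}" "\<lambda>i j. v i * X i j"]
    by (simp add: mult.commute)
  also have "\<dots> \<le> (\<Sum>i<m. \<bar>v i\<bar> * RD)"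
    using assms by (intro sum_mono) (auto simp: L2_set_scale intro: mult_left_mono)
  finally show ?thesis by (simp add: sum_distrib_left mult.commute)
qed

text \<open>The transpose is the adjoint: a gradient step in the weights is tested against the
  scores, where the surrogates are convex and the estimators have known means.\<close>

lemma sum_backproj_mult:
  "(\<Sum>j<d. backproj m X v j * (w j - w' j)) = (\<Sum>i<m. v i * (score d X w i - score d X w' i))"
proof -
  have "(\<Sum>j<d. backproj m X v j * (w j - w' j)) = (\<Sum>j<d. \<Sum>i<m. v i * (X i j * (w j - w' j)))"
    by (simp add: backproj_def sum_distrib_right mult.assoc mult.left_commute)
  also have "\<dots> = (\<Sum>i<m. v i * (\<Sum>j<d. X i j * (w j - w' j)))"
    by (subst sum.swap) (simp add: sum_distrib_left)
  finally show ?thesis by (simp add: score_def sum_subtractf[symmetric] right_diff_distrib)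
qed

lemma L2_set_project_le:
  assumes "0 \<le> U"
  shows "L2_set (project d U w) {..<d} \<le> U"
proof -
  have "L2_set (project d U w) {..<d} = \<bar>min 1 (U / L2_set w {..<d})\<bar> * L2_set w {..<d}"
    by (simp add: project_def L2_set_scale)
  also have "\<dots> = min 1 (U / L2_set w {..<d}) * L2_set w {..<d}"
    using assms by (simp add: min_def)
  also have "\<dots> \<le> U"
  proof (cases "L2_set w {..<d} = 0")
    case False
    then have "L2_set w {..<d} > 0" using L2_set_nonneg[of w "{..<d}"] by linarith
    have "min 1 (U / L2_set w {..<d}) * L2_set w {..<d} \<le> U / L2_set w {..<d} * L2_set w {..<d}"
      by (intro mult_right_mono) auto
    with False show ?thesis by simp
  qed (use assms in simp)
  finally show ?thesis .
qed

text \<open>If \<open>w\<close> lies outside the ball, its projection is c w with c = U / |w|. The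
  difference of the two sums is (1 - c) ((1 + c) |w|^2 - 2 <v, w>), and Cauchy-Schwarz with |v| <= U
  gives <v, w> <= c |w|^2, which leaves at least (1 - c)^2 |w|^2.\<close>

lemma project_contracts:
  assumes "L2_set v {..<d} \<le> U"
  shows "(\<Sum>j<d. (project d U w j - v j)\<^sup>2) \<le> (\<Sum>j<d. (w j - v j)\<^sup>2)"
proof (cases "L2_set w {..<d} \<le> U")
  case True
  show ?thesis
  proof (cases "L2_set w {..<d} = 0")
    case True
    \<comment> \<open>Here \<open>project\<close> scales by 0, as division by 0 yields 0; this is
      harmless because \<open>w\<close> vanishes on all features.\<close>
    then have "w j = 0" if "j < d" for j
      using that by (simp add: L2_set_eq_0_iff)
    then show ?thesis by (simp add: project_def)
  next
    case False
    then have "L2_set w {..<d} > 0" using L2_set_nonneg[of w "{..<d}"] by linarith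
    with True have "min 1 (U / L2_set w {..<d}) = 1" by simp
    then show ?thesis by (simp add: project_def)
  qed
next
  case False
  define c where "c = U / L2_set w {..<d}"
  have U: "0 \<le> U" using assms L2_set_nonneg[of v "{..<d}"] by linarith
  have pos: "L2_set w {..<d} > 0" using False U by linarith
  then have c: "0 \<le> c" "c \<le> 1" "c * L2_set w {..<d} = U"
    using False U by (auto simp: c_def)
  have pr: "project d U w j = c * w j" for j using c by (simp add: project_def c_def)
  have "(\<Sum>j<d. v j * w j) \<le> L2_set v {..<d} * L2_set w {..<d}"
    using sum_mult_le_L2_set[of v w "{..<d}"] by linarith
  also have "\<dots> \<le> U * L2_set w {..<d}" using assms pos by (simp add: mult_right_mono)
  also have "\<dots> = c * (L2_set w {..<d})\<^sup>2" using c(3) by (simp add: power2_eq_square)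
  also have "\<dots> = c * (\<Sum>j<d. (w j)\<^sup>2)" by (simp add: L2_set_power2)
  finally have vw: "(\<Sum>j<d. v j * w j) \<le> c * (\<Sum>j<d. (w j)\<^sup>2)" .
  have "(\<Sum>j<d. (w j - v j)\<^sup>2) - (\<Sum>j<d. (project d U w j - v j)\<^sup>2)
      = (\<Sum>j<d. (1 - c) * ((1 + c) * (w j)\<^sup>2 - 2 * (v j * w j)))"
    unfolding pr sum_subtractf[symmetric]
    by (intro sum.cong) (auto simp: power2_eq_square algebra_simps)
  also have "\<dots> = (1 - c) * ((1 + c) * (\<Sum>j<d. (w j)\<^sup>2) - 2 * (\<Sum>j<d. v j * w j))"
    unfolding sum_distrib_left[symmetric] sum_subtractf by (simp add: sum_distrib_left)
  also have "\<dots> \<ge> (1 - c) * ((1 + c) * (\<Sum>j<d. (w j)\<^sup>2) - 2 * (c * (\<Sum>j<d. (w j)\<^sup>2)))"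
    using c vw by (intro mult_left_mono) auto
  moreover have "(1 - c) * ((1 + c) * (\<Sum>j<d. (w j)\<^sup>2) - 2 * (c * (\<Sum>j<d. (w j)\<^sup>2)))
      = (1 - c)\<^sup>2 * (\<Sum>j<d. (w j)\<^sup>2)"
    by (simp add: power2_eq_square algebra_simps)
  moreover have "0 \<le> (1 - c)\<^sup>2 * (\<Sum>j<d. (w j)\<^sup>2)"
    by (intro mult_nonneg_nonneg sum_nonneg) auto
  ultimately show ?thesis by linarith
qed

section \<open>Rankings\<close>

text \<open>Expectation over the played ranking, kept as a finite sum so that bias and variance of
  the estimators are computed without measure theory. \<open>round_ranking_expectation\<close>
  connects it to the noise.\<close>

definition ranking_mean :: "nat \<Rightarrow> real \<Rightarrow> nat list \<Rightarrow> (nat list \<Rightarrow> real) \<Rightarrow> real" where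
  "ranking_mean m \<gamma> \<tau> f = (\<Sum>\<sigma>\<in>permutations_of_set {..<m}. ranking_prob m \<gamma> \<tau> \<sigma> * f \<sigma>)"

lemma argsort_permutation: "argsort m s \<in> permutations_of_set {..<m}"
  by (auto simp: argsort_def permutations_of_set_def)

lemma ranking_prob_nonneg: "0 \<le> \<gamma> \<Longrightarrow> \<gamma> \<le> 1 \<Longrightarrow> 0 \<le> ranking_prob m \<gamma> \<tau> \<sigma>"
  by (simp add: ranking_prob_def)

lemma ranking_prob_ge: "\<gamma> \<le> 1 \<Longrightarrow> \<gamma> / fact m \<le> ranking_prob m \<gamma> \<tau> \<sigma>"
  by (simp add: ranking_prob_def)

text \<open>The mixture of a point mass and the uniform law, in the shape in which the coin flip
  produces it.\<close>

lemma ranking_mean_split: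
  assumes "\<tau> \<in> permutations_of_set {..<m}"
  shows "ranking_mean m \<gamma> \<tau> f
    = (1 - \<gamma>) * f \<tau> + \<gamma> * ((\<Sum>\<sigma>\<in>permutations_of_set {..<m}. f \<sigma>) / fact m)"
proof -
  have "ranking_mean m \<gamma> \<tau> f = (\<Sum>\<sigma>\<in>permutations_of_set {..<m}. (if \<sigma> = \<tau> then (1 - \<gamma>) * f \<sigma> else 0))
      + (\<Sum>\<sigma>\<in>permutations_of_set {..<m}. \<gamma> / fact m * f \<sigma>)"
    unfolding ranking_mean_def ranking_prob_def sum.distrib[symmetric]
    by (intro sum.cong) (auto simp: algebra_simps)
  then show ?thesis
    using assms by (simp add: sum.delta' sum_distrib_left sum_divide_distrib)
qed

lemma ranking_mean_const:
  "\<tau> \<in> permutations_of_set {..<m} \<Longrightarrow> ranking_mean m \<gamma> \<tau> (\<lambda>_. c) = c"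
  by (simp add: ranking_mean_split algebra_simps)

lemma ranking_mean_add:
  "ranking_mean m \<gamma> \<tau> (\<lambda>\<sigma>. f \<sigma> + g \<sigma>) = ranking_mean m \<gamma> \<tau> f + ranking_mean m \<gamma> \<tau> g"
  by (simp add: ranking_mean_def algebra_simps sum.distrib)

lemma ranking_mean_scale:
  "ranking_mean m \<gamma> \<tau> (\<lambda>\<sigma>. c * f \<sigma>) = c * ranking_mean m \<gamma> \<tau> f"
  by (simp add: ranking_mean_def algebra_simps sum_distrib_left)

lemma ranking_mean_sum:
  "ranking_mean m \<gamma> \<tau> (\<lambda>\<sigma>. \<Sum>i\<in>I. f i \<sigma>) = (\<Sum>i\<in>I. ranking_mean m \<gamma> \<tau> (f i))"
  unfolding ranking_mean_def sum_distrib_left by (rule sum.swap)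

lemma ranking_mean_mono:
  assumes "0 \<le> \<gamma>" "\<gamma> \<le> 1" "\<And>\<sigma>. \<sigma> \<in> permutations_of_set {..<m} \<Longrightarrow> f \<sigma> \<le> g \<sigma>"
  shows "ranking_mean m \<gamma> \<tau> f \<le> ranking_mean m \<gamma> \<tau> g"
  unfolding ranking_mean_def
  using assms by (intro sum_mono mult_left_mono ranking_prob_nonneg) auto

lemma permutation_nth_less:
  assumes "\<sigma> \<in> permutations_of_set {..<m}" "k < m"
  shows "\<sigma> ! k < m"
  using assms nth_mem[of k \<sigma>] length_finite_permutations_of_set[OF assms(1)]
  by (auto simp: permutations_of_set_def)

lemma permutation_top2_distinct:
  fixes m :: nat
  assumes "\<sigma> \<in> permutations_of_set {..<m}" "2 \<le> m"
  shows "\<sigma> ! 0 \<noteq> \<sigma> ! 1"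
proof -
  have "distinct \<sigma>" "length \<sigma> = m"
    using permutations_of_setD[OF assms(1)] length_finite_permutations_of_set[OF assms(1)] by auto
  then show ?thesis using assms(2) by (subst nth_eq_iff_index_eq) auto
qed

text \<open>Grouping the rankings by their top document exposes the weight p(i), against which the
  factor 1 / p(i) of the estimators cancels.\<close>

lemma ranking_mean_top1:
  assumes "1 \<le> m"
  shows "ranking_mean m \<gamma> \<tau> (\<lambda>\<sigma>. f (\<sigma> ! 0)) = (\<Sum>i<m. top1_prob m \<gamma> \<tau> i * f i)"
proof -
  have "ranking_mean m \<gamma> \<tau> (\<lambda>\<sigma>. f (\<sigma> ! 0))
      = (\<Sum>i<m. \<Sum>\<sigma>\<in>{\<sigma> \<in> permutations_of_set {..<m}. \<sigma> ! 0 = i}. ranking_prob m \<gamma> \<tau> \<sigma> * f (\<sigma> ! 0))"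
    unfolding ranking_mean_def
    using assms by (intro sum.group[symmetric]) (auto intro: permutation_nth_less)
  also have "\<dots> = (\<Sum>i<m. top1_prob m \<gamma> \<tau> i * f i)"
    unfolding top1_prob_def sum_distrib_right by (intro sum.cong) auto
  finally show ?thesis .
qed

lemma ranking_mean_top2:
  assumes "2 \<le> m"
  shows "ranking_mean m \<gamma> \<tau> (\<lambda>\<sigma>. f (\<sigma> ! 0) (\<sigma> ! 1))
    = (\<Sum>i<m. \<Sum>j\<in>{..<m} - {i}. top2_prob m \<gamma> \<tau> i j * f i j)"
proof -
  let ?D = "SIGMA i:{..<m}. {..<m} - {i}"
  have "ranking_mean m \<gamma> \<tau> (\<lambda>\<sigma>. f (\<sigma> ! 0) (\<sigma> ! 1))
      = (\<Sum>p\<in>?D. \<Sum>\<sigma>\<in>{\<sigma> \<in> permutations_of_set {..<m}. (\<sigma> ! 0, \<sigma> ! 1) = p}.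
          ranking_prob m \<gamma> \<tau> \<sigma> * f (\<sigma> ! 0) (\<sigma> ! 1))"
    unfolding ranking_mean_def
    using assms by (intro sum.group[symmetric])
      (auto intro: permutation_nth_less dest: permutation_top2_distinct[OF _ assms])
  also have "\<dots> = (\<Sum>p\<in>?D. top2_prob m \<gamma> \<tau> (fst p) (snd p) * f (fst p) (snd p))"
    unfolding top2_prob_def sum_distrib_right by (intro sum.cong) auto
  also have "\<dots> = (\<Sum>i<m. \<Sum>j\<in>{..<m} - {i}. top2_prob m \<gamma> \<tau> i j * f i j)"
    by (subst sum.Sigma) (auto intro!: sum.cong)
  finally show ?thesis .
qed

section \<open>Counting rankings with prescribed top documents\<close>

lemma card_top1:
  assumes "i < m"
  shows "card {\<sigma> \<in> permutations_of_set {..<m}. \<sigma> ! 0 = i} = fact (m - 1)"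
proof -
  have ne: "{..<m} \<noteq> {}" using assms by auto
  have "{\<sigma> \<in> permutations_of_set {..<m}. \<sigma> ! 0 = i} = (#) i ` permutations_of_set ({..<m} - {i})"
    using assms unfolding permutations_of_set_nonempty[OF ne] by auto
  then show ?thesis using assms by (simp add: card_image)
qed

lemma card_top2:
  assumes "i < m" "j < m" "i \<noteq> j"
  shows "card {\<sigma> \<in> permutations_of_set {..<m}. \<sigma> ! 0 = i \<and> \<sigma> ! 1 = j} = fact (m - 2)"
proof -
  have ne: "{..<m} \<noteq> {}" "{..<m} - {i} \<noteq> {}" using assms by auto
  have "{\<sigma> \<in> permutations_of_set {..<m}. \<sigma> ! 0 = i \<and> \<sigma> ! 1 = j}
      = (\<lambda>\<sigma>. i # j # \<sigma>) ` permutations_of_set ({..<m} - {i} - {j})"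
    (is "?L = ?R")
  proof
    show "?L \<subseteq> ?R"
      using assms unfolding permutations_of_set_nonempty[OF ne(1)]
      by (auto simp: permutations_of_set_nonempty[OF ne(2)])
    show "?R \<subseteq> ?L"
    proof (rule image_subsetI)
      fix \<sigma> assume "\<sigma> \<in> permutations_of_set ({..<m} - {i} - {j})"
      then have *: "set \<sigma> = {..<m} - {i} - {j}" "distinct \<sigma>"
        by (blast dest: permutations_of_setD)+
      have "insert i (insert j ({..<m} - {i} - {j})) = {..<m}" using assms by auto
      with * have "set (i # j # \<sigma>) = {..<m}" by simp
      moreover have "distinct (i # j # \<sigma>)" unfolding distinct.simps list.set *(1) using assms *(2) by simp
      ultimately have "i # j # \<sigma> \<in> permutations_of_set {..<m}" by (rule permutations_of_setI)
      then show "i # j # \<sigma> \<in> ?L" by simp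
    qed
  qed
  moreover have "inj_on (\<lambda>\<sigma>. i # j # \<sigma>) S" for S by (auto simp: inj_on_def)
  moreover have "card ({..<m} - {i} - {j}) = m - 2" using assms by simp
  ultimately show ?thesis by (simp add: card_image)
qed

text \<open>The contribution of exploration alone: \<open>fact (m - 1)\<close> of the
  \<open>fact m\<close> rankings put \<open>i\<close> on top. It caps the importance weights by m /
  \<gamma>.\<close>

lemma top1_prob_ge:
  assumes "i < m" "\<gamma> \<le> 1"
  shows "\<gamma> / real m \<le> top1_prob m \<gamma> \<tau> i"
proof -
  have "fact m = real m * fact (m - 1)" using assms by (subst fact_reduce) auto
  then have "\<gamma> / real m = real (fact (m - 1)) * (\<gamma> / fact m)" using assms by simp
  also have "\<dots> = (\<Sum>\<sigma>\<in>{\<sigma> \<in> permutations_of_set {..<m}. \<sigma> ! 0 = i}. \<gamma> / fact m)"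
    using card_top1[OF assms(1)] by simp
  also have "\<dots> \<le> top1_prob m \<gamma> \<tau> i"
    unfolding top1_prob_def using assms by (intro sum_mono ranking_prob_ge)
  finally show ?thesis .
qed

text \<open>Exploration contributes \<gamma> / (m (m - 1)); this is weakened to m^2 so that the
  variance bound becomes a monomial in m.\<close>

lemma top2_prob_ge:
  assumes "i < m" "j < m" "i \<noteq> j" "0 \<le> \<gamma>" "\<gamma> \<le> 1"
  shows "\<gamma> / (real m)\<^sup>2 \<le> top2_prob m \<gamma> \<tau> i j"
proof -
  have "2 \<le> m" using assms by simp
  then have m: "fact m = real m * ((real m - 1) * fact (m - 2))"
    by (subst fact_reduce, simp, subst fact_reduce, simp)
      (simp add: of_nat_diff numeral_2_eq_2)
  have "\<gamma> / (real m)\<^sup>2 \<le> \<gamma> / (real m * (real m - 1))"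
    using \<open>2 \<le> m\<close> assms by (intro divide_left_mono) (auto simp: power2_eq_square intro!: mult_left_mono mult_pos_pos)
  also have "\<dots> = real (fact (m - 2)) * (\<gamma> / fact m)"
    unfolding m using \<open>2 \<le> m\<close> by simp
  also have "\<dots> = (\<Sum>\<sigma>\<in>{\<sigma> \<in> permutations_of_set {..<m}. \<sigma> ! 0 = i \<and> \<sigma> ! 1 = j}. \<gamma> / fact m)"
    using card_top2[OF assms(1-3)] by simp
  also have "\<dots> \<le> top2_prob m \<gamma> \<tau> i j"
    unfolding top2_prob_def using assms by (intro sum_mono ranking_prob_ge)
  finally show ?thesis .
qed

section \<open>Surrogates and gradient estimators\<close>

text \<open>A subgradient in the scores; \<open>backproj\<close> turns it into one in the weights.
  At the kink of the hinge the strict comparison in \<open>hinge_dir\<close> selects the zero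
  subgradient.\<close>

definition subgrad :: "surrogate \<Rightarrow> nat \<Rightarrow> (nat \<Rightarrow> real) \<Rightarrow> (nat \<Rightarrow> nat) \<Rightarrow> nat \<Rightarrow> real" where
  "subgrad \<phi> m s R l = (case \<phi> of
     SQ \<Rightarrow> 2 * (s l - real (R l))
   | SVM \<Rightarrow> (\<Sum>i<m. \<Sum>j\<in>{..<m} - {i}. hinge_dir s i (R i) j (R j) l)
   | KL \<Rightarrow> exp (s l) - exp (real (R l)))"

text \<open>The estimator before multiplication with the transpose of \<open>X\<close>, so a vector
  over documents, whose mean can be taken coordinate by coordinate.\<close>

definition est_dir ::
    "surrogate \<Rightarrow> nat \<Rightarrow> real \<Rightarrow> (nat \<Rightarrow> real) \<Rightarrow> (nat \<Rightarrow> nat) \<Rightarrow> nat list \<Rightarrow> nat \<Rightarrow> real" where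
  "est_dir \<phi> m \<gamma> s R \<sigma> l =
     (let p1 = top1_prob m \<gamma> (argsort m s); p2 = top2_prob m \<gamma> (argsort m s); a = \<sigma> ! 0; b = \<sigma> ! 1 in
      case \<phi> of
        SQ \<Rightarrow> 2 * (s l - real (R a) * basis_vec a l / p1 a)
      | SVM \<Rightarrow> (hinge_dir s a (R a) b (R b) l + hinge_dir s b (R b) a (R a) l) / (p2 a b + p2 b a)
      | KL \<Rightarrow> (exp (s a) - exp (real (R a))) * basis_vec a l / p1 a)"

text \<open>\<open>est_dir\<close> reads \<open>R\<close> only at documents whose relevance was
  observed; the feedback list is long enough because
  \<open>feedback_size \<phi> \<le> m\<close>.\<close>

lemma estimator_eq_backproj:
  assumes "\<sigma> \<in> permutations_of_set {..<m}" "feedback_size \<phi> \<le> m"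
  shows "estimator \<phi> m \<gamma> X s \<sigma> (feedback (feedback_size \<phi>) \<sigma> R)
    = backproj m X (est_dir \<phi> m \<gamma> s R \<sigma>)"
proof -
  have "length \<sigma> = m" using length_finite_permutations_of_set[OF assms(1)] by simp
  then have "k < feedback_size \<phi> \<Longrightarrow> feedback (feedback_size \<phi>) \<sigma> R ! k = R (\<sigma> ! k)" for k
    using assms(2) by (simp add: feedback_def)
  then show ?thesis
    by (cases \<phi>) (simp_all add: estimator_def est_dir_def[abs_def] Let_def)
qed

lemma sum_basis_vec_mult: "i < m \<Longrightarrow> (\<Sum>l<m. basis_vec i l * f l) = f i"
  by (simp add: basis_vec_def of_bool_def if_distrib[of "\<lambda>x. x * _"] sum.delta cong: if_cong)

lemma sum_hinge_dir_mult:
  assumes "i < m" "j < m"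
  shows "(\<Sum>l<m. hinge_dir s i r j r' l * f l)
    = of_bool (r > r') * of_bool (1 + s j > s i) * (f j - f i)"
proof -
  have "(\<Sum>l<m. hinge_dir s i r j r' l * f l) = of_bool (r > r') * of_bool (1 + s j > s i)
      * ((\<Sum>l<m. basis_vec j l * f l) - (\<Sum>l<m. basis_vec i l * f l))"
    unfolding hinge_dir_def sum_subtractf[symmetric] sum_distrib_left
    by (intro sum.cong) (auto simp: algebra_simps)
  with assms show ?thesis by (simp add: sum_basis_vec_mult)
qed

text \<open>Convexity, checked per document for SQ and KL and per pair for SVM. The gap is (s l - s'
  l)^2 for SQ; for KL it comes from 1 + x <= e^x at x = s' l - s l.\<close>

lemma loss_diff_le_subgrad:
  "loss \<phi> m s R - loss \<phi> m s' R \<le> (\<Sum>l<m. subgrad \<phi> m s R l * (s l - s' l))"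
proof (cases \<phi>)
  case SQ
  have "(s l - real (R l))\<^sup>2 - (s' l - real (R l))\<^sup>2 \<le> 2 * (s l - real (R l)) * (s l - s' l)" for l
    using zero_le_power2[of "s l - s' l"] by (simp add: power2_eq_square algebra_simps)
  then show ?thesis
    by (simp add: SQ loss_def subgrad_def L2_set_power2 sum_subtractf[symmetric] sum_mono)
next
  case SVM
  have "loss SVM m s R - loss SVM m s' R
      = (\<Sum>i<m. \<Sum>j\<in>{..<m} - {i}. of_bool (R i > R j) * (max 0 (1 + s j - s i) - max 0 (1 + s' j - s' i)))"
    by (simp only: loss_def surrogate.case sum_subtractf right_diff_distrib)
  also have "\<dots> \<le> (\<Sum>i<m. \<Sum>j\<in>{..<m} - {i}. of_bool (R i > R j) * of_bool (1 + s j > s i)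
      * ((s j - s' j) - (s i - s' i)))"
    by (intro sum_mono) (auto simp: max_def)
  also have "\<dots> = (\<Sum>i<m. \<Sum>j\<in>{..<m} - {i}. \<Sum>l<m. hinge_dir s i (R i) j (R j) l * (s l - s' l))"
    by (intro sum.cong) (auto simp: sum_hinge_dir_mult[where f = "\<lambda>l. s l - s' l"])
  also have "\<dots> = (\<Sum>l<m. \<Sum>i<m. \<Sum>j\<in>{..<m} - {i}. hinge_dir s i (R i) j (R j) l * (s l - s' l))"
    by (subst sum.swap, subst sum.swap) (intro sum.cong refl sum.swap)
  finally show ?thesis by (simp add: SVM subgrad_def sum_distrib_right)
next
  case KL
  have "exp (s l) - exp (s' l) \<le> exp (s l) * (s l - s' l)" for l
  proof -
    have "exp (s l) * (1 + (s' l - s l)) \<le> exp (s l) * exp (s' l - s l)"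
      by (intro mult_left_mono exp_ge_add_one_self) simp
    then show ?thesis by (simp add: exp_diff algebra_simps)
  qed
  then have *: "(exp (s l) - exp (real (R l)) * s l) - (exp (s' l) - exp (real (R l)) * s' l)
      \<le> (exp (s l) - exp (real (R l))) * (s l - s' l)" for l
    by (simp add: algebra_simps)
  have "loss KL m s R - loss KL m s' R
      = (\<Sum>l<m. (exp (s l) - exp (real (R l)) * s l) - (exp (s' l) - exp (real (R l)) * s' l))"
    by (simp add: loss_def sum_subtractf sum.distrib)
  also have "\<dots> \<le> (\<Sum>l<m. (exp (s l) - exp (real (R l))) * (s l - s' l))"
    using * by (intro sum_mono)
  finally show ?thesis by (simp add: KL subgrad_def)
qed

text \<open>Each KL summand is the Bregman divergence of exp between \<open>s i\<close> and
  \<open>R i\<close>, again nonnegative by 1 + x <= e^x.\<close>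

lemma loss_nonneg: "0 \<le> loss \<phi> m s R"
proof (cases \<phi>)
  case KL
  have "0 \<le> exp (real (R i)) * real (R i) - exp (real (R i)) * s i - exp (real (R i)) + exp (s i)" for i
  proof -
    have "exp (real (R i)) * (1 + (s i - real (R i))) \<le> exp (real (R i)) * exp (s i - real (R i))"
      by (intro mult_left_mono exp_ge_add_one_self) simp
    then show ?thesis by (simp add: exp_diff algebra_simps)
  qed
  then show ?thesis
    by (simp add: KL loss_def sum_subtractf[symmetric] sum.distrib[symmetric] sum_nonneg)
qed (auto simp: loss_def intro!: sum_nonneg)

text \<open>The cost of one exploring round. In (u - r)^2 the cross term has a favourable sign,
  whence n^2 + 1; a hinge is at most 2 on scores in [0, 1]; and the 3 for KL bounds e^1. For KL the
  exponential is factored out, to leave a polynomial.\<close>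

fun explore_bound :: "surrogate \<Rightarrow> real \<Rightarrow> real \<Rightarrow> real \<Rightarrow> real \<Rightarrow> real" where
  "explore_bound SQ RD m U n = m * (n\<^sup>2 + 1)"
| "explore_bound SVM RD m U n = 2 * m\<^sup>2"
| "explore_bound KL RD m U n = exp (max n (RD * U)) * (m * (n + 3))"

lemma loss_explore_le:
  assumes "\<And>i. i < m \<Longrightarrow> 0 \<le> u i \<and> u i \<le> 1" "\<And>i. i < m \<Longrightarrow> R i \<le> n" "0 \<le> RD" "0 \<le> U"
  shows "loss \<phi> m u R \<le> explore_bound \<phi> RD (real m) U (real n)"
proof (cases \<phi>)
  case SQ
  have "(u i - real (R i))\<^sup>2 \<le> (real n)\<^sup>2 + 1" if "i < m" for i
  proof -
    have "(u i)\<^sup>2 \<le> 1" "0 \<le> u i * real (R i)"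
      using assms(1)[OF that] by (auto intro: power_le_one)
    then have "(u i - real (R i))\<^sup>2 \<le> (real (R i))\<^sup>2 + 1"
      unfolding power2_diff by linarith
    also have "\<dots> \<le> (real n)\<^sup>2 + 1"
      using assms(2)[OF that] by (intro add_right_mono power_mono) auto
    finally show ?thesis .
  qed
  then have "(\<Sum>i<m. (u i - real (R i))\<^sup>2) \<le> (\<Sum>i<m. (real n)\<^sup>2 + 1)"
    by (intro sum_mono) auto
  then show ?thesis by (simp add: SQ loss_def L2_set_power2)
next
  case SVM
  have "of_bool (R j < R i) * max 0 (1 + u j - u i) \<le> 2" if "i < m" "j < m" for i j
    using assms(1)[OF that(1)] assms(1)[OF that(2)] by auto
  then have "(\<Sum>i<m. \<Sum>j\<in>{..<m} - {i}. of_bool (R i > R j) * max 0 (1 + u j - u i))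
      \<le> (\<Sum>i<m. \<Sum>j\<in>{..<m} - {i}. 2)"
    by (intro sum_mono) auto
  also have "\<dots> \<le> (\<Sum>i<m. 2 * real m)"
    by (intro sum_mono) auto
  finally show ?thesis by (simp add: SVM loss_def power2_eq_square mult_ac)
next
  case KL
  let ?E = "exp (max (real n) (RD * U))"
  have E: "1 \<le> ?E" using assms by (simp add: max_def)
  have "exp (real (R i)) * real (R i) - exp (real (R i)) * u i - exp (real (R i)) + exp (u i)
      \<le> ?E * (real n + 3)" if "i < m" for i
  proof -
    have "exp (real (R i)) * real (R i) \<le> ?E * real n"
      using assms(2)[OF that] by (intro mult_mono) (auto simp: max_def)
    moreover have "exp (u i) \<le> exp 1" using assms(1)[OF that] by simp
    moreover have "exp 1 \<le> (3::real)" by (rule exp_le)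
    moreover have "0 \<le> exp (real (R i)) * u i" using assms(1)[OF that] by simp
    moreover have "0 \<le> exp (real (R i))" by simp
    ultimately show ?thesis using E unfolding distrib_left by linarith
  qed
  then have "(\<Sum>i<m. exp (real (R i)) * real (R i) - exp (real (R i)) * u i - exp (real (R i)) + exp (u i))
      \<le> (\<Sum>i<m. ?E * (real n + 3))"
    by (intro sum_mono) auto
  then show ?thesis by (simp add: KL loss_def sum_subtractf sum.distrib mult_ac)
qed

section \<open>Mean and second moment of the estimators\<close>

lemma top1_prob_pos: "i < m \<Longrightarrow> 0 < \<gamma> \<Longrightarrow> \<gamma> \<le> 1 \<Longrightarrow> 0 < top1_prob m \<gamma> \<tau> i"
  using top1_prob_ge[of i m \<gamma> \<tau>] divide_pos_pos[of \<gamma> "real m"] by linarith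

lemma top2_prob_pos:
  assumes "i < m" "j < m" "i \<noteq> j" "0 < \<gamma>" "\<gamma> \<le> 1"
  shows "0 < top2_prob m \<gamma> \<tau> i j"
proof -
  have "0 < \<gamma> / (real m)\<^sup>2" using assms by simp
  with top2_prob_ge[of i m j \<gamma> \<tau>] assms show ?thesis by linarith
qed

text \<open>Dividing by the symmetrized weights compensates for seeing each pair in both orders.\<close>

lemma sum_pairs_symmetrize:
  fixes p h :: "nat \<Rightarrow> nat \<Rightarrow> real"
  assumes "\<And>i j. i < m \<Longrightarrow> j < m \<Longrightarrow> i \<noteq> j \<Longrightarrow> p i j > 0"
  shows "(\<Sum>i<m. \<Sum>j\<in>{..<m} - {i}. p i j * ((h i j + h j i) / (p i j + p j i)))
    = (\<Sum>i<m. \<Sum>j\<in>{..<m} - {i}. h i j)"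
proof -
  let ?S = "\<lambda>f. \<Sum>i<m. \<Sum>j\<in>{..<m} - {i}. f i j :: real"
  have swap: "?S f = ?S (\<lambda>i j. f j i)" for f
  proof -
    \<comment> \<open>Padding with a zero diagonal makes the two index ranges independent, so that
      \<open>sum.swap\<close> applies.\<close>
    have *: "?S g = (\<Sum>i<m. \<Sum>j<m. if i = j then 0 else g i j)" for g
      by (intro sum.cong refl sum.mono_neutral_cong_left) auto
    show ?thesis unfolding * by (subst sum.swap) (intro sum.cong, auto)
  qed
  have "?S (\<lambda>i j. p i j * ((h i j + h j i) / (p i j + p j i)))
      = ?S (\<lambda>i j. p i j * h i j / (p i j + p j i)) + ?S (\<lambda>i j. p i j * h j i / (p i j + p j i))"
    by (simp add: sum.distrib[symmetric] add_divide_distrib algebra_simps)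
  also have "?S (\<lambda>i j. p i j * h j i / (p i j + p j i)) = ?S (\<lambda>i j. p j i * h i j / (p j i + p i j))"
    by (rule swap)
  also have "?S (\<lambda>i j. p i j * h i j / (p i j + p j i)) + \<dots> = ?S h"
    unfolding sum.distrib[symmetric]
  proof (intro sum.cong refl)
    fix i j assume "i \<in> {..<m}" "j \<in> {..<m} - {i}"
    then have "p i j > 0" "p j i > 0" using assms by auto
    then have "p i j + p j i \<noteq> 0" by linarith
    moreover have "p i j * h i j / (p i j + p j i) + p j i * h i j / (p j i + p i j)
        = (p i j + p j i) * h i j / (p i j + p j i)"
      by (simp add: add_divide_distrib distrib_right add.commute)
    ultimately show "p i j * h i j / (p i j + p j i) + p j i * h i j / (p j i + p i j) = h i j"
      by simp
  qed
  finally show ?thesis .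
qed

text \<open>Unbiasedness by importance weighting: the probability of seeing a document or pair
  cancels the division by it, and exploration keeps that probability positive. The SVM subgradient
  is a sum over pairs, which is why two relevances must be observed.\<close>

lemma ranking_mean_est_dir:
  assumes "feedback_size \<phi> \<le> m" "0 < \<gamma>" "\<gamma> \<le> 1" "l < m"
  shows "ranking_mean m \<gamma> (argsort m s) (\<lambda>\<sigma>. est_dir \<phi> m \<gamma> s R \<sigma> l) = subgrad \<phi> m s R l"
proof -
  let ?M = "ranking_mean m \<gamma> (argsort m s)"
  let ?p1 = "top1_prob m \<gamma> (argsort m s)"
  let ?p2 = "top2_prob m \<gamma> (argsort m s)"
  have m: "1 \<le> m" using assms by simp
  have inv: "?M (\<lambda>\<sigma>. f (\<sigma> ! 0) * basis_vec (\<sigma> ! 0) l / ?p1 (\<sigma> ! 0)) = f l" for f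
  proof -
    have "?M (\<lambda>\<sigma>. f (\<sigma> ! 0) * basis_vec (\<sigma> ! 0) l / ?p1 (\<sigma> ! 0))
        = (\<Sum>i<m. ?p1 i * (f i * basis_vec i l / ?p1 i))"
      by (rule ranking_mean_top1[OF m])
    also have "\<dots> = (\<Sum>i<m. if i = l then f i else 0)"
      using top1_prob_pos[OF _ assms(2,3)]
      by (intro sum.cong) (auto simp: basis_vec_def less_imp_neq[symmetric] dest!: less_imp_neq)
    also have "\<dots> = f l" using assms by (simp add: sum.delta)
    finally show ?thesis .
  qed
  show ?thesis
  proof (cases \<phi>)
    case SQ
    have "?M (\<lambda>\<sigma>. est_dir \<phi> m \<gamma> s R \<sigma> l)
        = ?M (\<lambda>\<sigma>. 2 * s l + (- 2) * (real (R (\<sigma> ! 0)) * basis_vec (\<sigma> ! 0) l / ?p1 (\<sigma> ! 0)))"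
      by (simp add: SQ est_dir_def Let_def algebra_simps)
    also have "\<dots> = 2 * s l + (- 2) * real (R l)"
      by (simp only: ranking_mean_add ranking_mean_scale inv[of "\<lambda>i. real (R i)"] ranking_mean_const[OF argsort_permutation])
    finally show ?thesis by (simp add: SQ subgrad_def)
  next
    case SVM
    let ?h = "\<lambda>i j. hinge_dir s i (R i) j (R j) l"
    have "?M (\<lambda>\<sigma>. est_dir \<phi> m \<gamma> s R \<sigma> l)
        = (\<Sum>i<m. \<Sum>j\<in>{..<m} - {i}. ?p2 i j * ((?h i j + ?h j i) / (?p2 i j + ?p2 j i)))"
      unfolding SVM est_dir_def Let_def surrogate.case
      using assms(1) SVM by (intro ranking_mean_top2) simp
    also have "\<dots> = (\<Sum>i<m. \<Sum>j\<in>{..<m} - {i}. ?h i j)"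
      using assms by (intro sum_pairs_symmetrize top2_prob_pos)
    finally show ?thesis by (simp add: SVM subgrad_def)
  next
    case KL
    then show ?thesis
      using inv[of "\<lambda>i. exp (s i) - exp (real (R i))"] by (simp add: est_dir_def Let_def subgrad_def)
  qed
qed

text \<open>The coefficient A of the self-bounding term. For SQ, Cauchy-Schwarz bounds the squared
  l1 norm of 2 (s - R) by 4 m times the loss, and splitting the square of a sum doubles this. The
  other two estimators have bounds free of the loss.\<close>

fun smooth_const :: "surrogate \<Rightarrow> real \<Rightarrow> real \<Rightarrow> real" where
  "smooth_const SQ RD m = 8 * m * RD\<^sup>2"
| "smooth_const SVM RD m = 0"
| "smooth_const KL RD m = 0"

fun var_const :: "surrogate \<Rightarrow> real \<Rightarrow> real \<Rightarrow> real \<Rightarrow> real \<Rightarrow> real" where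
  "var_const SQ RD m U n = 32 * (m * RD * n)\<^sup>2"
| "var_const SVM RD m U n = 4 * (m\<^sup>2 * RD)\<^sup>2"
| "var_const KL RD m U n = (m * RD * exp (max n (RD * U)))\<^sup>2"

lemma sum_abs_basis_vec: "i < m \<Longrightarrow> (\<Sum>l<m. \<bar>c * basis_vec i l\<bar>) = \<bar>c\<bar>"
  using sum_basis_vec_mult[of i m "\<lambda>_. \<bar>c\<bar>"]
  by (simp add: abs_mult basis_vec_def mult.commute)

text \<open>One of the two factors 1 / p cancels against the probability of the observation, so the
  moment is of order 1 / \<gamma> and not 1 / \<gamma>^2. The rate T^(2/3) rests on this.\<close>

lemma top1_inverse_moment:
  assumes "1 \<le> m" "0 < \<gamma>" "\<gamma> \<le> 1" "0 \<le> c"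
  shows "ranking_mean m \<gamma> \<tau> (\<lambda>\<sigma>. c / (top1_prob m \<gamma> \<tau> (\<sigma> ! 0))\<^sup>2) \<le> c * (real m)\<^sup>2 / \<gamma>"
proof -
  have "ranking_mean m \<gamma> \<tau> (\<lambda>\<sigma>. c / (top1_prob m \<gamma> \<tau> (\<sigma> ! 0))\<^sup>2)
      = (\<Sum>i<m. top1_prob m \<gamma> \<tau> i * (c / (top1_prob m \<gamma> \<tau> i)\<^sup>2))"
    by (rule ranking_mean_top1[OF assms(1)])
  also have "\<dots> \<le> (\<Sum>i<m. c * real m / \<gamma>)"
  proof (intro sum_mono)
    fix i assume i: "i \<in> {..<m}"
    have p: "0 < top1_prob m \<gamma> \<tau> i" using i assms by (simp add: top1_prob_pos)
    have "top1_prob m \<gamma> \<tau> i * (c / (top1_prob m \<gamma> \<tau> i)\<^sup>2) = c / top1_prob m \<gamma> \<tau> i"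
      using p by (simp add: power2_eq_square)
    also have "\<dots> \<le> c / (\<gamma> / real m)"
      using i assms p by (intro divide_left_mono top1_prob_ge mult_pos_pos) auto
    finally show "top1_prob m \<gamma> \<tau> i * (c / (top1_prob m \<gamma> \<tau> i)\<^sup>2) \<le> c * real m / \<gamma>" by simp
  qed
  also have "\<dots> = c * (real m)\<^sup>2 / \<gamma>" by (simp add: power2_eq_square mult_ac)
  finally show ?thesis .
qed

lemma top2_inverse_moment:
  assumes "2 \<le> m" "0 < \<gamma>" "\<gamma> \<le> 1" "0 \<le> c"
  shows "ranking_mean m \<gamma> \<tau>
      (\<lambda>\<sigma>. c / (top2_prob m \<gamma> \<tau> (\<sigma> ! 0) (\<sigma> ! 1) + top2_prob m \<gamma> \<tau> (\<sigma> ! 1) (\<sigma> ! 0))\<^sup>2)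
    \<le> c * (real m)^4 / \<gamma>"
proof -
  let ?p = "top2_prob m \<gamma> \<tau>"
  have "ranking_mean m \<gamma> \<tau> (\<lambda>\<sigma>. c / (?p (\<sigma> ! 0) (\<sigma> ! 1) + ?p (\<sigma> ! 1) (\<sigma> ! 0))\<^sup>2)
      = (\<Sum>i<m. \<Sum>j\<in>{..<m} - {i}. ?p i j * (c / (?p i j + ?p j i)\<^sup>2))"
    by (rule ranking_mean_top2[OF assms(1)])
  also have "\<dots> \<le> (\<Sum>i<m. \<Sum>j\<in>{..<m} - {i}. c * (real m)\<^sup>2 / \<gamma>)"
  proof (intro sum_mono)
    fix i j assume ij: "i \<in> {..<m}" "j \<in> {..<m} - {i}"
    have p: "0 < ?p i j" "0 < ?p j i" using ij assms by (auto simp: top2_prob_pos)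
    \<comment> \<open>Enlarging the weight to the symmetrized one lets it cancel one factor of the
      squared denominator.\<close>
    have "?p i j * (c / (?p i j + ?p j i)\<^sup>2) \<le> (?p i j + ?p j i) * (c / (?p i j + ?p j i)\<^sup>2)"
      using p assms by (intro mult_right_mono) auto
    also have "\<dots> = c / (?p i j + ?p j i)" using p by (simp add: power2_eq_square)
    also have "\<dots> \<le> c / ?p i j"
      using p assms by (intro divide_left_mono mult_pos_pos) auto
    also have "\<dots> \<le> c / (\<gamma> / (real m)\<^sup>2)"
      using ij assms p by (intro divide_left_mono top2_prob_ge mult_pos_pos) auto
    finally show "?p i j * (c / (?p i j + ?p j i)\<^sup>2) \<le> c * (real m)\<^sup>2 / \<gamma>" by simp
  qed
  also have "\<dots> \<le> (\<Sum>i<m. real m * (c * (real m)\<^sup>2 / \<gamma>))"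
    using assms by (intro sum_mono) (auto intro!: mult_right_mono divide_right_mono)
  also have "\<dots> = c * (real m)^4 / \<gamma>" by (simp add: power2_eq_square power4_eq_xxxx mult_ac)
  finally show ?thesis .
qed

text \<open>For SQ the direction is split into the true gradient 2 (s - R), controlled by the loss,
  and the remainder 2 (R - R_a e_a / p(a)), in which the scores no longer occur. So no power of RD *
  U enters. For KL the scores are bounded through the projection, which is where
  \<open>s i \<le> RD * U\<close> comes in.\<close>

lemma estimator_second_moment:
  assumes "feedback_size \<phi> \<le> m" "0 < \<gamma>" "\<gamma> \<le> 1" "0 \<le> RD"
    and X: "\<And>i. i < m \<Longrightarrow> L2_set (X i) {..<d} \<le> RD"
    and R: "\<And>i. i < m \<Longrightarrow> R i \<le> n"
    and s: "\<And>i. i < m \<Longrightarrow> s i \<le> RD * U"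
  shows "ranking_mean m \<gamma> (argsort m s) (\<lambda>\<sigma>. (L2_set (backproj m X (est_dir \<phi> m \<gamma> s R \<sigma>)) {..<d})\<^sup>2)
    \<le> smooth_const \<phi> RD (real m) * loss \<phi> m s R + var_const \<phi> RD (real m) U (real n) / \<gamma>"
proof -
  let ?M = "ranking_mean m \<gamma> (argsort m s)"
  let ?p1 = "top1_prob m \<gamma> (argsort m s)"
  let ?p2 = "top2_prob m \<gamma> (argsort m s)"
  let ?N = "\<lambda>v. L2_set (backproj m X v) {..<d}"
  have m: "1 \<le> m" using assms(1) by (cases \<phi>) auto
  have N: "(?N v)\<^sup>2 \<le> RD\<^sup>2 * c\<^sup>2" if "(\<Sum>l<m. \<bar>v l\<bar>) \<le> c" for v c
  proof -
    have "?N v \<le> RD * (\<Sum>l<m. \<bar>v l\<bar>)" by (rule L2_set_backproj_le[OF X])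
    also have "\<dots> \<le> RD * c" using that assms by (intro mult_left_mono)
    finally have "(?N v)\<^sup>2 \<le> (RD * c)\<^sup>2" by (intro power_mono L2_set_nonneg)
    then show ?thesis by (simp add: power_mult_distrib)
  qed
  have sq2: "(2 * x + 2 * y)\<^sup>2 \<le> 8 * x\<^sup>2 + 8 * y\<^sup>2" for x y :: real
    using zero_le_power2[of "x - y"] by (simp add: power2_eq_square algebra_simps)
  show ?thesis
  proof (cases \<phi>)
    case SQ
    have *: "(?N (est_dir \<phi> m \<gamma> s R \<sigma>))\<^sup>2
        \<le> (8 * real m * RD\<^sup>2 * loss \<phi> m s R + 16 * (real m * RD * real n)\<^sup>2)
          + 16 * (RD * real n)\<^sup>2 / (?p1 (\<sigma> ! 0))\<^sup>2"
      if \<sigma>: "\<sigma> \<in> permutations_of_set {..<m}" for \<sigma>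
    proof -
      let ?a = "\<sigma> ! 0"
      let ?x = "\<lambda>l. 2 * (s l - real (R l))"
      let ?y = "\<lambda>l. 2 * (real (R l) - real (R ?a) * basis_vec ?a l / ?p1 ?a)"
      have a: "?a < m" using \<sigma> m by (simp add: permutation_nth_less)
      have p: "0 < ?p1 ?a" using a assms by (simp add: top1_prob_pos)
      have "backproj m X (est_dir \<phi> m \<gamma> s R \<sigma>) = (\<lambda>j. backproj m X ?x j + backproj m X ?y j)"
        by (simp add: SQ est_dir_def Let_def backproj_def fun_eq_iff sum.distrib[symmetric]
            distrib_left[symmetric])
      then have "?N (est_dir \<phi> m \<gamma> s R \<sigma>) \<le> ?N ?x + ?N ?y"
        using L2_set_triangle_ineq[of "backproj m X ?x" "backproj m X ?y" "{..<d}"] by simp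
      then have "(?N (est_dir \<phi> m \<gamma> s R \<sigma>))\<^sup>2 \<le> (?N ?x + ?N ?y)\<^sup>2"
        by (intro power_mono L2_set_nonneg)
      also have "\<dots> \<le> 2 * (?N ?x)\<^sup>2 + 2 * (?N ?y)\<^sup>2"
        using zero_le_power2[of "?N ?x - ?N ?y"] by (simp add: power2_diff power2_sum)
      finally have 1: "(?N (est_dir \<phi> m \<gamma> s R \<sigma>))\<^sup>2 \<le> 2 * (?N ?x)\<^sup>2 + 2 * (?N ?y)\<^sup>2" .
      \<comment> \<open>Cauchy-Schwarz against the all-ones vector passes from the l1 norm to the
        squared loss, at the price of a factor m.\<close>
      have "(\<Sum>l<m. \<bar>?x l\<bar>)\<^sup>2 \<le> (\<Sum>l<m. 1\<^sup>2) * (\<Sum>l<m. \<bar>?x l\<bar>\<^sup>2)"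
        using Cauchy_Schwarz_ineq_sum[of "\<lambda>_. 1" "\<lambda>l. \<bar>?x l\<bar>" "{..<m}"] by simp
      also have "(\<Sum>l<m. \<bar>?x l\<bar>\<^sup>2) = 4 * loss \<phi> m s R"
        unfolding SQ loss_def surrogate.case L2_set_power2 sum_distrib_left power2_abs power_mult_distrib
        by simp
      also have "(\<Sum>l<m. 1\<^sup>2) * (4 * loss \<phi> m s R) = 4 * real m * loss \<phi> m s R" by simp
      finally have "RD\<^sup>2 * (\<Sum>l<m. \<bar>?x l\<bar>)\<^sup>2 \<le> RD\<^sup>2 * (4 * real m * loss \<phi> m s R)"
        by (intro mult_left_mono) auto
      with N[of ?x, OF order_refl] have 2: "(?N ?x)\<^sup>2 \<le> 4 * real m * RD\<^sup>2 * loss \<phi> m s R"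
        by (simp add: mult_ac)
      have "(\<Sum>l<m. \<bar>?y l\<bar>) \<le> (\<Sum>l<m. 2 * real (R l) + 2 * \<bar>(real (R ?a) / ?p1 ?a) * basis_vec ?a l\<bar>)"
        by (intro sum_mono) (auto simp: abs_mult abs_if)
      also have "\<dots> = 2 * (\<Sum>l<m. real (R l)) + 2 * (real (R ?a) / ?p1 ?a)"
        using a p by (simp add: sum.distrib sum_distrib_left[symmetric] sum_abs_basis_vec del: times_divide_eq_left)
      also have "\<dots> \<le> 2 * (real m * real n) + 2 * (real n / ?p1 ?a)"
        using sum_bounded_above[of "{..<m}" "\<lambda>l. real (R l)" "real n"] R a p
        by (intro add_mono mult_left_mono divide_right_mono) auto
      finally have "(?N ?y)\<^sup>2 \<le> RD\<^sup>2 * (2 * (real m * real n) + 2 * (real n / ?p1 ?a))\<^sup>2"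
        by (rule N)
      also have "\<dots> \<le> RD\<^sup>2 * (8 * (real m * real n)\<^sup>2 + 8 * (real n / ?p1 ?a)\<^sup>2)"
        by (intro mult_left_mono sq2) auto
      also have "\<dots> = 8 * (real m * RD * real n)\<^sup>2 + 8 * (RD * real n)\<^sup>2 / (?p1 ?a)\<^sup>2"
        by (simp add: power_mult_distrib power_divide algebra_simps)
      finally show ?thesis using 1 2 by simp
    qed
    have "?M (\<lambda>\<sigma>. (?N (est_dir \<phi> m \<gamma> s R \<sigma>))\<^sup>2)
        \<le> ?M (\<lambda>\<sigma>. (8 * real m * RD\<^sup>2 * loss \<phi> m s R + 16 * (real m * RD * real n)\<^sup>2)
          + 16 * (RD * real n)\<^sup>2 / (?p1 (\<sigma> ! 0))\<^sup>2)"
      using assms * by (intro ranking_mean_mono) auto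
    also have "\<dots> \<le> 8 * real m * RD\<^sup>2 * loss \<phi> m s R + 16 * (real m * RD * real n)\<^sup>2
        + 16 * (RD * real n)\<^sup>2 * (real m)\<^sup>2 / \<gamma>"
      unfolding ranking_mean_add ranking_mean_const[OF argsort_permutation]
      using m assms by (intro add_left_mono top1_inverse_moment) auto
    \<comment> \<open>As 1 <= 1 / \<gamma>, this part joins the importance-weighted one: 16 + 16 =
      32 in \<open>var_const\<close>.\<close>
    also have "16 * (real m * RD * real n)\<^sup>2 \<le> 16 * (real m * RD * real n)\<^sup>2 / \<gamma>"
      using assms by (simp add: pos_le_divide_eq mult_left_le)
    finally show ?thesis by (simp add: SQ power_mult_distrib mult_ac)
  next
    case SVM
    have m2: "2 \<le> m" using assms(1) SVM by simp
    have *: "(?N (est_dir \<phi> m \<gamma> s R \<sigma>))\<^sup>2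
        \<le> RD\<^sup>2 * 4 / (?p2 (\<sigma> ! 0) (\<sigma> ! 1) + ?p2 (\<sigma> ! 1) (\<sigma> ! 0))\<^sup>2"
      if \<sigma>: "\<sigma> \<in> permutations_of_set {..<m}" for \<sigma>
    proof -
      let ?a = "\<sigma> ! 0" and ?b = "\<sigma> ! 1"
      let ?q = "?p2 ?a ?b + ?p2 ?b ?a"
      have ab: "?a < m" "?b < m" "?a \<noteq> ?b"
        using \<sigma> m2 by (auto intro: permutation_nth_less dest: permutation_top2_distinct)
      have q: "0 < ?q" using ab assms by (intro add_pos_pos top2_prob_pos) auto
      have "\<bar>est_dir \<phi> m \<gamma> s R \<sigma> l\<bar> \<le> \<bar>1 / ?q * basis_vec ?a l\<bar> + \<bar>1 / ?q * basis_vec ?b l\<bar>" for l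
      proof -
        \<comment> \<open>The relevances of the two documents cannot each exceed the other, so at
          most one of the two directions is nonzero.\<close>
        have num: "\<bar>hinge_dir s ?a (R ?a) ?b (R ?b) l + hinge_dir s ?b (R ?b) ?a (R ?a) l\<bar>
            \<le> basis_vec ?a l + basis_vec ?b l"
          by (auto simp: hinge_dir_def basis_vec_def)
        have "\<bar>est_dir \<phi> m \<gamma> s R \<sigma> l\<bar>
            = \<bar>hinge_dir s ?a (R ?a) ?b (R ?b) l + hinge_dir s ?b (R ?b) ?a (R ?a) l\<bar> / ?q"
          using q by (simp only: SVM est_dir_def Let_def surrogate.case abs_divide abs_of_pos)
        also have "\<dots> \<le> (basis_vec ?a l + basis_vec ?b l) / ?q"
          using num q by (intro divide_right_mono) auto
        also have "\<dots> = \<bar>1 / ?q * basis_vec ?a l\<bar> + \<bar>1 / ?q * basis_vec ?b l\<bar>"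
          using q by (simp add: abs_mult basis_vec_def add_divide_distrib)
        finally show ?thesis .
      qed
      then have "(\<Sum>l<m. \<bar>est_dir \<phi> m \<gamma> s R \<sigma> l\<bar>)
          \<le> (\<Sum>l<m. \<bar>1 / ?q * basis_vec ?a l\<bar> + \<bar>1 / ?q * basis_vec ?b l\<bar>)"
        by (intro sum_mono)
      also have "\<dots> = 2 / ?q"
        using ab q unfolding sum.distrib by (simp add: sum_abs_basis_vec del: times_divide_eq_left)
      finally have "(?N (est_dir \<phi> m \<gamma> s R \<sigma>))\<^sup>2 \<le> RD\<^sup>2 * (2 / ?q)\<^sup>2" by (rule N)
      then show ?thesis by (simp add: power_divide)
    qed
    have "?M (\<lambda>\<sigma>. (?N (est_dir \<phi> m \<gamma> s R \<sigma>))\<^sup>2)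
        \<le> ?M (\<lambda>\<sigma>. RD\<^sup>2 * 4 / (?p2 (\<sigma> ! 0) (\<sigma> ! 1) + ?p2 (\<sigma> ! 1) (\<sigma> ! 0))\<^sup>2)"
      using assms * by (intro ranking_mean_mono) auto
    also have "\<dots> \<le> RD\<^sup>2 * 4 * (real m)^4 / \<gamma>"
      using m2 assms by (intro top2_inverse_moment) auto
    finally show ?thesis by (simp add: SVM power_mult_distrib mult_ac)
  next
    case KL
    let ?E = "exp (max (real n) (RD * U))"
    have *: "(?N (est_dir \<phi> m \<gamma> s R \<sigma>))\<^sup>2 \<le> RD\<^sup>2 * ?E\<^sup>2 / (?p1 (\<sigma> ! 0))\<^sup>2"
      if \<sigma>: "\<sigma> \<in> permutations_of_set {..<m}" for \<sigma>
    proof -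
      let ?a = "\<sigma> ! 0"
      have a: "?a < m" using \<sigma> m by (simp add: permutation_nth_less)
      have p: "0 < ?p1 ?a" using a assms by (simp add: top1_prob_pos)
      have "exp (s ?a) \<le> ?E" "exp (real (R ?a)) \<le> ?E"
        using s[OF a] R[OF a] by (auto simp: max_def)
      \<comment> \<open>Two positive numbers below the same bound differ by at most that bound, so
        no factor 2 arises.\<close>
      then have E: "\<bar>exp (s ?a) - exp (real (R ?a))\<bar> \<le> ?E"
        using exp_gt_zero[of "s ?a"] exp_gt_zero[of "real (R ?a)"] by linarith
      have "(\<Sum>l<m. \<bar>est_dir \<phi> m \<gamma> s R \<sigma> l\<bar>)
          = (\<Sum>l<m. \<bar>(exp (s ?a) - exp (real (R ?a))) / ?p1 ?a * basis_vec ?a l\<bar>)"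
        by (simp add: KL est_dir_def Let_def)
      also have "\<dots> \<le> ?E / ?p1 ?a"
        unfolding sum_abs_basis_vec[OF a] using E p by (simp add: divide_right_mono)
      finally have "(?N (est_dir \<phi> m \<gamma> s R \<sigma>))\<^sup>2 \<le> RD\<^sup>2 * (?E / ?p1 ?a)\<^sup>2" by (rule N)
      then show ?thesis by (simp add: power_divide)
    qed
    have "?M (\<lambda>\<sigma>. (?N (est_dir \<phi> m \<gamma> s R \<sigma>))\<^sup>2) \<le> ?M (\<lambda>\<sigma>. RD\<^sup>2 * ?E\<^sup>2 / (?p1 (\<sigma> ! 0))\<^sup>2)"
      using assms * by (intro ranking_mean_mono) auto
    also have "\<dots> \<le> RD\<^sup>2 * ?E\<^sup>2 * (real m)\<^sup>2 / \<gamma>"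
      using m assms by (intro top1_inverse_moment) auto
    finally show ?thesis by (simp add: KL power_mult_distrib mult_ac)
  qed
qed

section \<open>Uniform scores give a uniform ranking\<close>

abbreviation unif_scores :: "nat \<Rightarrow> (nat \<Rightarrow> real) measure" where
  "unif_scores m \<equiv> \<Pi>\<^sub>M i\<in>{..<m}. uniform_measure lborel {0..1}"

lemma prob_space_unif: "prob_space (uniform_measure lborel {0..1::real})"
  by (rule prob_space_uniform_measure) auto

lemma prob_space_unif_scores: "prob_space (unif_scores m)"
  by (intro prob_space_PiM prob_space_unif)

lemma AE_unif_scores_range: "AE u in unif_scores m. \<forall>i<m. 0 \<le> u i \<and> u i \<le> 1"
proof -
  have "AE u in unif_scores m. \<forall>i\<in>{..<m}. 0 \<le> u i \<and> u i \<le> 1"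
  proof (intro AE_finite_allI finite_lessThan AE_PiM_component prob_space_unif)
    show "AE x in uniform_measure lborel {0..1::real}. 0 \<le> x \<and> x \<le> 1"
      by (rule AE_uniform_measureI) auto
  qed auto
  then show ?thesis by (rule eventually_mono) auto
qed

text \<open>With all coordinates but \<open>i\<close> fixed, a tie with \<open>j\<close> confines
  coordinate \<open>i\<close> to a single point, a Lebesgue null set. Fubini then makes the
  probability of the tie 0.\<close>

lemma AE_unif_scores_inj: "AE u in unif_scores m. inj_on u {..<m}"
proof -
  have "AE u in unif_scores m. u i \<noteq> u j" if ij: "i < m" "j < m" "i \<noteq> j" for i j
  proof -
    interpret U: prob_space "uniform_measure lborel {0..1::real}" by (rule prob_space_unif)
    interpret P: product_sigma_finite "\<lambda>_::nat. uniform_measure lborel {0..1::real}"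
      by standard
    interpret M: prob_space "unif_scores m" by (rule prob_space_unif_scores)
    let ?A = "{u \<in> space (unif_scores m). u i = u j}"
    let ?f = "\<lambda>u :: nat \<Rightarrow> real. of_bool (u i = u j) :: real"
    have ins: "insert i ({..<m} - {i}) = {..<m}" using ij by auto
    have [measurable]: "(\<lambda>u. u i) \<in> borel_measurable (unif_scores m)"
      "(\<lambda>u. u j) \<in> borel_measurable (unif_scores m)"
      using ij by (auto intro!: measurable_PiM_component_rev)
    have A: "?A \<in> sets (unif_scores m)" by measurable
    have "?f \<in> borel_measurable (unif_scores m)" unfolding of_bool_def by measurable
    then have int: "integrable (unif_scores m) ?f"
      by (intro M.integrable_const_bound[of _ 1]) auto
    have "(\<integral>u. ?f u \<partial>unif_scores m)
        = (\<integral>x. (\<integral>y. ?f (x(i := y)) \<partial>uniform_measure lborel {0..1}) \<partial>PiM ({..<m} - {i}) (\<lambda>_. uniform_measure lborel {0..1}))"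
      using P.product_integral_insert[of "{..<m} - {i}" i ?f] int unfolding ins by simp
    also have "\<dots> = 0"
    proof -
      have "(\<integral>y. ?f (x(i := y)) \<partial>uniform_measure lborel {0..1}) = 0" for x :: "nat \<Rightarrow> real"
      proof -
        have "AE y in lborel. y \<noteq> x j" by (rule AE_lborel_singleton)
        then have "AE y in uniform_measure lborel {0..1}. y \<noteq> x j"
          by (intro AE_uniform_measureI) auto
        then have "AE y in uniform_measure lborel {0..1}. ?f (x(i := y)) = 0"
          using ij by (auto elim!: eventually_mono)
        then show ?thesis by (rule integral_eq_zero_AE)
      qed
      then show ?thesis by simp
    qed
    finally have "(\<integral>u. ?f u \<partial>unif_scores m) = 0" .
    then have "AE u in unif_scores m. ?f u = 0"
      using int by (subst (asm) integral_nonneg_eq_0_iff_AE) auto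
    then show ?thesis by (auto elim!: eventually_mono)
  qed
  then have "AE u in unif_scores m. \<forall>i\<in>{..<m}. \<forall>j\<in>{..<m} - {i}. u i \<noteq> u j"
    by (intro AE_finite_allI) auto
  then show ?thesis by (rule eventually_mono) (auto simp: inj_on_def)
qed

text \<open>Follows the recursion of insertion sort: every insertion branches on comparisons of two
  coordinates, and the intermediate lists are countably many, so they can be fixed one at a
  time.\<close>

lemma argsort_measurable [measurable]:
  "argsort m \<in> unif_scores m \<rightarrow>\<^sub>M count_space UNIV"
proof -
  have comp: "(\<lambda>u. u i) \<in> borel_measurable (unif_scores m)" if "i < m" for i
    using that by (auto intro!: measurable_PiM_component_rev)
  have ins: "(\<lambda>u. insort_key (\<lambda>i. - u i) x ys) \<in> unif_scores m \<rightarrow>\<^sub>M count_space UNIV"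
    if "x < m" "set ys \<subseteq> {..<m}" for x ys
    using that(2)
  proof (induction ys)
    case (Cons y ys)
    then have [measurable]: "(\<lambda>u. insort_key (\<lambda>i. - u i) x ys) \<in> unif_scores m \<rightarrow>\<^sub>M count_space UNIV"
      by simp
    have [measurable]: "Measurable.pred (unif_scores m) (\<lambda>u. - u x \<le> - u y)"
      unfolding pred_def using Cons.prems that(1)
      by (intro borel_measurable_le borel_measurable_uminus comp) auto
    show ?case unfolding insort_key.simps by measurable
  qed simp
  \<comment> \<open>The target space records that only documents below \<open>m\<close> occur, since
    only their scores are coordinates of \<open>unif_scores m\<close>.\<close>
  have "(\<lambda>u. foldr (insort_key (\<lambda>i. - u i)) xs []) \<in> unif_scores m \<rightarrow>\<^sub>M count_space {ys. set ys \<subseteq> {..<m}}"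
    if "set xs \<subseteq> {..<m}" for xs
    using that
  proof (induction xs)
    case (Cons x xs)
    have "(\<lambda>u. insort_key (\<lambda>i. - u i) x (foldr (insort_key (\<lambda>i. - u i)) xs []))
        \<in> unif_scores m \<rightarrow>\<^sub>M count_space UNIV"
    proof (rule measurable_compose_countable'[where I = "{ys. set ys \<subseteq> {..<m}}"
          and f = "\<lambda>ys u. insort_key (\<lambda>i. - u i) x ys"])
      show "(\<lambda>u. foldr (insort_key (\<lambda>i. - u i)) xs []) \<in> unif_scores m \<rightarrow>\<^sub>M count_space {ys. set ys \<subseteq> {..<m}}"
        using Cons.IH Cons.prems by simp
      fix ys assume "ys \<in> {ys. set ys \<subseteq> {..<m}}"
      then show "(\<lambda>u. insort_key (\<lambda>i. - u i) x ys) \<in> unif_scores m \<rightarrow>\<^sub>M count_space UNIV"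
        using Cons.prems by (intro ins) auto
    qed (rule countableI_type)
    moreover have "set (foldr (insort_key (\<lambda>i. - u i)) zs []) = set zs" for u :: "nat \<Rightarrow> real" and zs
      by (induction zs) (auto simp: set_insort_key)
    ultimately show ?case
      using Cons.prems by (auto simp: measurable_count_space_eq_countable set_insort_key)
  qed auto
  from measurable_compose[OF this[of "[0..<m]"], of "\<lambda>ys. ys" "count_space UNIV"] show ?thesis
    unfolding argsort_def[abs_def] sort_key_def by (simp add: lessThan_atLeast0)
qed

text \<open>Without ties there is only one sorted arrangement. Sortedness, unlike the value of
  \<open>argsort\<close>, is easily followed through a permutation of the coordinates.\<close>

lemma argsort_eq_iff:
  assumes "inj_on s {..<m}" "\<sigma> \<in> permutations_of_set {..<m}"
  shows "argsort m s = \<sigma> \<longleftrightarrow> sorted (map (\<lambda>i. - s i) \<sigma>)"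
proof
  assume "sorted (map (\<lambda>i. - s i) \<sigma>)"
  moreover have "set \<sigma> = {..<m}" "distinct \<sigma>" using permutations_of_setD[OF assms(2)] by auto
  moreover have "set (argsort m s) = {..<m}" "distinct (argsort m s)" "sorted (map (\<lambda>i. - s i) (argsort m s))"
    by (auto simp: argsort_def)
  moreover have "inj_on (\<lambda>i. - s i) {..<m}" using assms(1) by (auto simp: inj_on_def)
  ultimately show "argsort m s = \<sigma>"
    by (intro map_sorted_distinct_set_unique[of "\<lambda>i. - s i"]) (auto simp: distinct_map)
qed (auto simp: argsort_def)

text \<open>Permuting the coordinates of the scores preserves their distribution and moves any
  ranking to the identity.\<close>

lemma prob_argsort_eq_upt:
  assumes \<sigma>: "\<sigma> \<in> permutations_of_set {..<m}"
  shows "measure (unif_scores m) {u \<in> space (unif_scores m). argsort m u = \<sigma>}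
    = measure (unif_scores m) {u \<in> space (unif_scores m). argsort m u = [0..<m]}"
proof -
  interpret M: prob_space "unif_scores m" by (rule prob_space_unif_scores)
  define h where "h = (\<lambda>u :: nat \<Rightarrow> real. \<lambda>n\<in>{..<m}. u (\<sigma> ! n))"
  have len: "length \<sigma> = m" and d: "distinct \<sigma>"
    using length_finite_permutations_of_set[OF \<sigma>] permutations_of_setD[OF \<sigma>] by auto
  have nth: "n < m \<Longrightarrow> \<sigma> ! n < m" for n using permutation_nth_less[OF \<sigma>] by simp
  have inj: "inj_on ((!) \<sigma>) {..<m}" using d len by (auto intro: inj_on_nth)
  have dist: "distr (unif_scores m) (unif_scores m) h = unif_scores m"
    unfolding h_def using inj nth prob_space_unif
    by (intro distr_PiM_reindex[where M = "\<lambda>_. uniform_measure lborel {0..1::real}"]) auto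
  have h [measurable]: "h \<in> unif_scores m \<rightarrow>\<^sub>M unif_scores m"
    unfolding h_def using nth by (intro measurable_restrict measurable_component_singleton) auto
  have upt: "[0..<m] \<in> permutations_of_set {..<m}" by (auto intro!: permutations_of_setI)
  have "argsort m u = \<sigma> \<longleftrightarrow> argsort m (h u) = [0..<m]" if u: "inj_on u {..<m}" for u
  proof -
    have hu: "inj_on (h u) {..<m}"
    proof (rule inj_onI)
      fix x y assume "x \<in> {..<m}" "y \<in> {..<m}" "h u x = h u y"
      then show "x = y" using u inj nth by (auto simp: h_def inj_on_def)
    qed
    \<comment> \<open>Reading \<open>h u\<close> in the identity order is reading \<open>u\<close>
      in the order \<open>\<sigma>\<close>.\<close>
    have "map (\<lambda>i. - h u i) [0..<m] = map (\<lambda>i. - u i) (map ((!) \<sigma>) [0..<m])"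
      by (simp add: h_def)
    also have "map ((!) \<sigma>) [0..<m] = \<sigma>" using map_nth[of \<sigma>] len by simp
    finally show ?thesis using argsort_eq_iff[OF u \<sigma>] argsort_eq_iff[OF hu upt] by simp
  qed
  then have "measure (unif_scores m) {u \<in> space (unif_scores m). argsort m u = \<sigma>}
      = measure (unif_scores m) {u \<in> space (unif_scores m). argsort m (h u) = [0..<m]}"
    using AE_unif_scores_inj[of m] by (intro M.finite_measure_eq_AE) (auto elim!: eventually_mono)
  also have "{u \<in> space (unif_scores m). argsort m (h u) = [0..<m]}
      = h -` {u \<in> space (unif_scores m). argsort m u = [0..<m]} \<inter> space (unif_scores m)"
    using measurable_space[OF h] by auto
  also have "measure (unif_scores m) \<dots>
      = measure (distr (unif_scores m) (unif_scores m) h) {u \<in> space (unif_scores m). argsort m u = [0..<m]}"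
    by (subst measure_distr) auto
  finally show ?thesis unfolding dist .
qed

lemma argsort_expectation:
  fixes g :: "nat list \<Rightarrow> real"
  shows "integrable (unif_scores m) (\<lambda>u. g (argsort m u))"
    and "(\<integral>u. g (argsort m u) \<partial>unif_scores m) = (\<Sum>\<sigma>\<in>permutations_of_set {..<m}. g \<sigma>) / fact m"
proof -
  interpret M: prob_space "unif_scores m" by (rule prob_space_unif_scores)
  let ?E = "\<lambda>\<sigma>. {u \<in> space (unif_scores m). argsort m u = \<sigma>}"
  let ?p = "measure (unif_scores m) (?E [0..<m])"
  have E [measurable]: "?E \<sigma> \<in> sets (unif_scores m)" for \<sigma> by measurable
  have expand: "h (argsort m u) = (\<Sum>\<sigma>\<in>permutations_of_set {..<m}. h \<sigma> * indicator (?E \<sigma>) u)"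
    if "u \<in> space (unif_scores m)" for u and h :: "nat list \<Rightarrow> real"
    using that argsort_permutation[of m u]
    by (simp add: indicator_def if_distrib[of "\<lambda>x. _ * x"] sum.delta cong: if_cong)
  have int: "integrable (unif_scores m) (\<lambda>u. \<Sum>\<sigma>\<in>permutations_of_set {..<m}. h \<sigma> * indicator (?E \<sigma>) u)"
    for h :: "nat list \<Rightarrow> real"
    by (intro Bochner_Integration.integrable_sum integrable_mult_right integrable_real_indicator) (auto simp: M.emeasure_eq_measure)
  have val: "(\<integral>u. h (argsort m u) \<partial>unif_scores m) = ?p * (\<Sum>\<sigma>\<in>permutations_of_set {..<m}. h \<sigma>)"
    for h :: "nat list \<Rightarrow> real"
  proof -
    have "(\<integral>u. h (argsort m u) \<partial>unif_scores m)
        = (\<integral>u. (\<Sum>\<sigma>\<in>permutations_of_set {..<m}. h \<sigma> * indicator (?E \<sigma>) u) \<partial>unif_scores m)"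
      by (intro Bochner_Integration.integral_cong expand refl)
    also have "\<dots> = (\<Sum>\<sigma>\<in>permutations_of_set {..<m}. h \<sigma> * measure (unif_scores m) (?E \<sigma>))"
      by (subst Bochner_Integration.integral_sum)
        (auto intro!: integrable_mult_right integrable_real_indicator simp: M.emeasure_eq_measure Int_absorb1)
    also have "\<dots> = (\<Sum>\<sigma>\<in>permutations_of_set {..<m}. h \<sigma> * ?p)"
      by (intro sum.cong) (auto simp: prob_argsort_eq_upt)
    finally show ?thesis by (simp add: sum_distrib_right[symmetric] mult.commute)
  qed
  show "integrable (unif_scores m) (\<lambda>u. g (argsort m u))"
    using int[of g] by (subst Bochner_Integration.integrable_cong[OF refl expand])
  \<comment> \<open>All rankings share the probability \<open>?p\<close>; the constant function 1
    determines it.\<close>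
  have "?p * fact m = 1" using val[of "\<lambda>_. 1"] M.prob_space by simp
  then have "?p = 1 / fact m" by (simp add: field_simps)
  with val[of g] show "(\<integral>u. g (argsort m u) \<partial>unif_scores m) = (\<Sum>\<sigma>\<in>permutations_of_set {..<m}. g \<sigma>) / fact m"
    by simp
qed

section \<open>Averaging over a round\<close>

lemma prob_space_round_noise: "prob_space (round_noise m \<gamma>)"
  unfolding round_noise_def
  by (intro prob_space_pair prob_space_unif_scores measure_pmf.prob_space_axioms)

lemma prob_space_run_noise: "prob_space (run_noise T m \<gamma>)"
  unfolding run_noise_def by (intro prob_space_PiM prob_space_round_noise)

lemma measurable_coin [measurable]: "fst \<in> round_noise m \<gamma> \<rightarrow>\<^sub>M count_space UNIV"
  unfolding round_noise_def
  by (rule measurable_compose[OF measurable_fst]) simp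

lemma measurable_explore [measurable]: "snd \<in> round_noise m \<gamma> \<rightarrow>\<^sub>M unif_scores m"
  unfolding round_noise_def by (rule measurable_snd)

lemma round_expectation:
  fixes f :: "(nat \<Rightarrow> real) \<Rightarrow> real"
  assumes "0 \<le> \<gamma>" "\<gamma> \<le> 1" and f: "integrable (unif_scores m) f"
  shows "integrable (round_noise m \<gamma>) (\<lambda>\<xi>. if fst \<xi> then f (snd \<xi>) else c)"
    and "(\<integral>\<xi>. (if fst \<xi> then f (snd \<xi>) else c) \<partial>round_noise m \<gamma>)
      = \<gamma> * (\<integral>u. f u \<partial>unif_scores m) + (1 - \<gamma>) * c"
proof -
  let ?B = "measure_pmf (bernoulli_pmf \<gamma>)"
  let ?g = "\<lambda>\<xi>. if fst \<xi> then f (snd \<xi>) else c"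
  interpret M: prob_space "unif_scores m" by (rule prob_space_unif_scores)
  interpret P: pair_prob_space ?B "unif_scores m" by standard
  have [measurable]: "f \<in> borel_measurable (unif_scores m)" using f by simp
  have "?g \<in> borel_measurable (round_noise m \<gamma>)" by measurable
  then have "integrable (?B \<Otimes>\<^sub>M unif_scores m) ?g"
  proof (intro P.Fubini_integrable integrable_measure_pmf_finite)
    have "integrable (unif_scores m) (\<lambda>u. ?g (b, u))" for b
      using f by (cases b) auto
    then show "AE b in ?B. integrable (unif_scores m) (\<lambda>u. ?g (b, u))" by simp
  qed (auto simp: round_noise_def intro: finite_subset[OF subset_UNIV])
  then show "integrable (round_noise m \<gamma>) ?g" unfolding round_noise_def .
  have "(\<integral>\<xi>. ?g \<xi> \<partial>round_noise m \<gamma>) = (\<integral>b. (\<integral>u. ?g (b, u) \<partial>unif_scores m) \<partial>?B)"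
    unfolding round_noise_def by (rule P.integral_fst'[symmetric]) fact
  also have "\<dots> = \<gamma> * (\<integral>u. f u \<partial>unif_scores m) + (1 - \<gamma>) * c"
    using assms M.prob_space by simp
  finally show "(\<integral>\<xi>. ?g \<xi> \<partial>round_noise m \<gamma>) = \<gamma> * (\<integral>u. f u \<partial>unif_scores m) + (1 - \<gamma>) * c" .
qed

text \<open>The played ranking has the law \<open>ranking_prob\<close>: exploiting gives the point
  mass, exploring the uniform part.\<close>

lemma round_ranking_expectation:
  fixes g :: "nat list \<Rightarrow> real"
  assumes "0 \<le> \<gamma>" "\<gamma> \<le> 1"
  shows "integrable (round_noise m \<gamma>) (\<lambda>\<xi>. g (argsort m (played_score s \<xi>)))"
    and "(\<integral>\<xi>. g (argsort m (played_score s \<xi>)) \<partial>round_noise m \<gamma>) = ranking_mean m \<gamma> (argsort m s) g"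
proof -
  have *: "(\<lambda>\<xi>. g (argsort m (played_score s \<xi>)))
      = (\<lambda>\<xi>. if fst \<xi> then g (argsort m (snd \<xi>)) else g (argsort m s))"
    by (auto simp: played_score_def)
  show "integrable (round_noise m \<gamma>) (\<lambda>\<xi>. g (argsort m (played_score s \<xi>)))"
    unfolding * by (intro round_expectation assms argsort_expectation)
  show "(\<integral>\<xi>. g (argsort m (played_score s \<xi>)) \<partial>round_noise m \<gamma>) = ranking_mean m \<gamma> (argsort m s) g"
    unfolding * round_expectation(2)[OF assms argsort_expectation(1)] argsort_expectation(2)
    by (simp add: ranking_mean_split[OF argsort_permutation])
qed

text \<open>Exploiting has weight 1 - \<gamma>, which is dropped since losses are nonnegative;
  exploring has weight \<gamma> and almost surely uses scores in [0, 1].\<close>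

lemma round_loss_expectation:
  assumes "0 \<le> \<gamma>" "\<gamma> \<le> 1" "0 \<le> RD" "0 \<le> U" "\<And>i. i < m \<Longrightarrow> R i \<le> n"
  shows "integrable (round_noise m \<gamma>) (\<lambda>\<xi>. loss \<phi> m (played_score s \<xi>) R)"
    and "(\<integral>\<xi>. loss \<phi> m (played_score s \<xi>) R \<partial>round_noise m \<gamma>)
      \<le> loss \<phi> m s R + \<gamma> * explore_bound \<phi> RD (real m) U (real n)"
proof -
  interpret M: prob_space "unif_scores m" by (rule prob_space_unif_scores)
  let ?D = "explore_bound \<phi> RD (real m) U (real n)"
  have *: "(\<lambda>\<xi>. loss \<phi> m (played_score s \<xi>) R)
      = (\<lambda>\<xi>. if fst \<xi> then loss \<phi> m (snd \<xi>) R else loss \<phi> m s R)"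
    by (auto simp: played_score_def)
  have le: "AE u in unif_scores m. loss \<phi> m u R \<le> ?D"
    using AE_unif_scores_range by (rule eventually_mono) (use assms in \<open>auto intro: loss_explore_le\<close>)
  have [measurable]: "(\<lambda>u. u i) \<in> borel_measurable (unif_scores m)" if "i < m" for i
    using that by (auto intro!: measurable_PiM_component_rev)
  have meas: "(\<lambda>u. loss \<phi> m u R) \<in> borel_measurable (unif_scores m)"
    by (cases \<phi>) (auto simp: loss_def L2_set_power2 intro!: borel_measurable_sum borel_measurable_diff
      borel_measurable_add borel_measurable_times borel_measurable_power borel_measurable_max)
  have int: "integrable (unif_scores m) (\<lambda>u. loss \<phi> m u R)"
    using le by (intro M.integrable_const_bound[of _ ?D] meas) (auto elim!: eventually_mono simp: loss_nonneg)
  show "integrable (round_noise m \<gamma>) (\<lambda>\<xi>. loss \<phi> m (played_score s \<xi>) R)"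
    unfolding * by (intro round_expectation assms int)
  have "(\<integral>u. loss \<phi> m u R \<partial>unif_scores m) \<le> (\<integral>u. ?D \<partial>unif_scores m)"
    using int le by (intro integral_mono_AE) auto
  then have "\<gamma> * (\<integral>u. loss \<phi> m u R \<partial>unif_scores m) \<le> \<gamma> * ?D"
    using assms M.prob_space by (intro mult_left_mono) auto
  moreover have "(1 - \<gamma>) * loss \<phi> m s R \<le> loss \<phi> m s R"
    using assms loss_nonneg by (intro mult_left_le_one_le) auto
  ultimately show "(\<integral>\<xi>. loss \<phi> m (played_score s \<xi>) R \<partial>round_noise m \<gamma>) \<le> loss \<phi> m s R + \<gamma> * ?D"
    unfolding * round_expectation(2)[OF assms(1,2) int] by linarith
qed

section \<open>Conditioning on the past through finitely many histories\<close>

text \<open>The part of a round's noise that the algorithm reacts to; it takes countably many values.\<close>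

definition noise_key :: "nat \<Rightarrow> noise \<Rightarrow> bool \<times> nat list" where
  "noise_key m \<xi> = (fst \<xi>, argsort m (snd \<xi>))"

definition history :: "nat \<Rightarrow> nat \<Rightarrow> (nat \<Rightarrow> noise) \<Rightarrow> (bool \<times> nat list) list" where
  "history m t \<omega> = map (\<lambda>i. noise_key m (\<omega> i)) [0..<t]"

lemma history_measurable:
  assumes "t \<le> T"
  shows "history m t \<in> run_noise T m \<gamma> \<rightarrow>\<^sub>M count_space UNIV"
  using assms
proof (induction t)
  case (Suc t)
  have [measurable]: "noise_key m \<in> round_noise m \<gamma> \<rightarrow>\<^sub>M count_space UNIV"
  proof -
    have "(\<lambda>\<xi>. (fst \<xi>, argsort m (snd \<xi>))) \<in> round_noise m \<gamma> \<rightarrow>\<^sub>M count_space UNIV"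
    proof (rule measurable_compose_countable[where g = fst and f = "\<lambda>b \<xi>. (b, argsort m (snd \<xi>))"])
      fix b :: bool
      have "(\<lambda>\<xi>. argsort m (snd \<xi>)) \<in> round_noise m \<gamma> \<rightarrow>\<^sub>M count_space UNIV" by measurable
      from measurable_compose[OF this, of "Pair b" "count_space UNIV"]
      show "(\<lambda>\<xi>. (b, argsort m (snd \<xi>))) \<in> round_noise m \<gamma> \<rightarrow>\<^sub>M count_space UNIV" by simp
    qed (rule measurable_coin)
    then show ?thesis by (simp add: noise_key_def[abs_def])
  qed
  have comp: "(\<lambda>\<omega>. noise_key m (\<omega> t)) \<in> run_noise T m \<gamma> \<rightarrow>\<^sub>M count_space UNIV"
    unfolding run_noise_def using Suc.prems by (intro measurable_PiM_component_rev) auto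
  have "(\<lambda>\<omega>. history m t \<omega> @ [noise_key m (\<omega> t)]) \<in> run_noise T m \<gamma> \<rightarrow>\<^sub>M count_space UNIV"
  proof (rule measurable_compose_countable[where g = "history m t" and f = "\<lambda>l \<omega>. l @ [noise_key m (\<omega> t)]"])
    show "history m t \<in> run_noise T m \<gamma> \<rightarrow>\<^sub>M count_space UNIV" using Suc by simp
    show "(\<lambda>\<omega>. l @ [noise_key m (\<omega> t)]) \<in> run_noise T m \<gamma> \<rightarrow>\<^sub>M count_space UNIV" for l
      using measurable_compose[OF comp, of "\<lambda>k. l @ [k]" "count_space UNIV"] by simp
  qed
  then show ?case by (simp add: history_def[abs_def])
qed (simp add: history_def[abs_def])

text \<open>Finiteness makes every function of the history bounded, and splits a run into finitely
  many events on which the past is constant.\<close>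

lemma history_finite_range: "finite (range (history m t))"
proof (rule finite_subset)
  let ?K = "UNIV \<times> permutations_of_set {..<m} :: (bool \<times> nat list) set"
  show "range (history m t) \<subseteq> {xs. set xs \<subseteq> ?K \<and> length xs = t}"
    by (auto simp: history_def noise_key_def argsort_permutation)
  show "finite {xs. set xs \<subseteq> ?K \<and> length xs = t}" by (rule finite_lists_length_eq) simp
qed

text \<open>Plays the part of conditional expectation given the past. The history at
  \<open>t\<close> reads only earlier rounds, so coordinate \<open>t\<close> can be integrated out
  while the history stays fixed.\<close>

lemma run_expectation:
  fixes G :: "(bool \<times> nat list) list \<Rightarrow> noise \<Rightarrow> real"
  assumes t: "t < T" and G: "\<And>l. integrable (round_noise m \<gamma>) (G l)"
  shows "integrable (run_noise T m \<gamma>) (\<lambda>\<omega>. G (history m t \<omega>) (\<omega> t))"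
    and "(\<integral>\<omega>. G (history m t \<omega>) (\<omega> t) \<partial>run_noise T m \<gamma>)
      = (\<integral>\<omega>. (\<integral>\<xi>. G (history m t \<omega>) \<xi> \<partial>round_noise m \<gamma>) \<partial>run_noise T m \<gamma>)"
proof -
  interpret N: prob_space "round_noise m \<gamma>" by (rule prob_space_round_noise)
  interpret P: product_sigma_finite "\<lambda>_::nat. round_noise m \<gamma>"
    by standard
  have hist [measurable]: "history m t \<in> run_noise T m \<gamma> \<rightarrow>\<^sub>M count_space UNIV"
    using t by (intro history_measurable) simp
  have int: "integrable (run_noise T m \<gamma>) (\<lambda>\<omega>. H (history m t \<omega>) (\<omega> t))"
    if H: "\<And>l. integrable (round_noise m \<gamma>) (H l)" for H :: "(bool \<times> nat list) list \<Rightarrow> noise \<Rightarrow> real"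
  proof -
    let ?E = "\<lambda>l. {\<omega> \<in> space (run_noise T m \<gamma>). history m t \<omega> = l}"
    have comp: "integrable (run_noise T m \<gamma>) (\<lambda>\<omega>. H l (\<omega> t))" for l
    proof -
      have "distr (run_noise T m \<gamma>) (round_noise m \<gamma>) (\<lambda>\<omega>. \<omega> t) = round_noise m \<gamma>"
        unfolding run_noise_def using t by (intro distr_PiM_component prob_space_round_noise) auto
      moreover have "(\<lambda>\<omega>. \<omega> t) \<in> run_noise T m \<gamma> \<rightarrow>\<^sub>M round_noise m \<gamma>"
        unfolding run_noise_def using t by (intro measurable_component_singleton) auto
      ultimately show ?thesis using H[of l] by (metis integrable_distr)
    qed
    have "?E l \<in> sets (run_noise T m \<gamma>)" for l by measurable
    then have "integrable (run_noise T m \<gamma>)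
        (\<lambda>\<omega>. \<Sum>l\<in>range (history m t). H l (\<omega> t) * indicator (?E l) \<omega>)"
      using comp by (intro Bochner_Integration.integrable_sum integrable_real_mult_indicator) auto
    moreover have "H (history m t \<omega>) (\<omega> t) = (\<Sum>l\<in>range (history m t). H l (\<omega> t) * indicator (?E l) \<omega>)"
      if "\<omega> \<in> space (run_noise T m \<gamma>)" for \<omega>
      using that history_finite_range[of m t]
      by (simp add: indicator_def if_distrib[of "\<lambda>x. _ * x"] sum.delta cong: if_cong)
    ultimately show ?thesis by (subst Bochner_Integration.integrable_cong[OF refl])
  qed
  have ins: "insert t ({..<T} - {t}) = {..<T}" using t by auto
  have upd: "history m t (fun_upd \<omega> t \<xi>) = history m t \<omega>" for \<omega> \<xi>
    by (simp add: history_def)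
  have fold: "(\<integral>\<omega>. H (history m t \<omega>) (\<omega> t) \<partial>run_noise T m \<gamma>)
      = (\<integral>\<omega>. (\<integral>\<xi>. H (history m t \<omega>) \<xi> \<partial>round_noise m \<gamma>) \<partial>(\<Pi>\<^sub>M i\<in>{..<T} - {t}. round_noise m \<gamma>))"
    if H: "\<And>l. integrable (round_noise m \<gamma>) (H l)" for H :: "(bool \<times> nat list) list \<Rightarrow> noise \<Rightarrow> real"
    using P.product_integral_insert[of "{..<T} - {t}" t "\<lambda>\<omega>. H (history m t \<omega>) (\<omega> t)"] int[of H, OF H]
    unfolding ins run_noise_def by (simp add: upd)
  show "integrable (run_noise T m \<gamma>) (\<lambda>\<omega>. G (history m t \<omega>) (\<omega> t))" by (rule int[of G, OF G])
  show "(\<integral>\<omega>. G (history m t \<omega>) (\<omega> t) \<partial>run_noise T m \<gamma>)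
      = (\<integral>\<omega>. (\<integral>\<xi>. G (history m t \<omega>) \<xi> \<partial>round_noise m \<gamma>) \<partial>run_noise T m \<gamma>)"
    \<comment> \<open>The second use of \<open>fold\<close>, on a function constant in the noise of
      round \<open>t\<close>, puts that round back into the outer integral.\<close>
    using fold[of G, OF G] fold[of "\<lambda>l _. \<integral>\<xi>. G l \<xi> \<partial>round_noise m \<gamma>"] N.prob_space by simp
qed

lemma run_integrable:
  fixes f :: "(bool \<times> nat list) list \<Rightarrow> real"
  assumes "t \<le> T"
  shows "integrable (run_noise T m \<gamma>) (\<lambda>\<omega>. f (history m t \<omega>))"
proof -
  interpret prob_space "run_noise T m \<gamma>" by (rule prob_space_run_noise)
  have "(\<lambda>\<omega>. f (history m t \<omega>)) \<in> borel_measurable (run_noise T m \<gamma>)"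
    using measurable_compose[OF history_measurable[OF assms], of f borel] by simp
  moreover have "\<bar>f (history m t \<omega>)\<bar> \<le> Max ((\<lambda>l. \<bar>f l\<bar>) ` range (history m t))" for \<omega>
    using history_finite_range[of m t] by (intro Max_ge) auto
  ultimately show ?thesis by (intro integrable_const_bound) auto
qed

text \<open>The update reacts to the explored scores only through their ranking, and to the coin.
  The witness reads the key of round \<open>t\<close> off the end of the list and the earlier
  history off \<open>butlast\<close>.\<close>

lemma rtop_weight_history:
  "\<exists>W. \<forall>\<omega>. rtop_weight \<phi> m d U \<eta> \<gamma> X R \<omega> t = W (history m t \<omega>)"
proof (induction t)
  case (Suc t)
  then obtain W where W: "\<And>\<omega>. rtop_weight \<phi> m d U \<eta> \<gamma> X R \<omega> t = W (history m t \<omega>)" by auto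
  have played: "argsort m (played_score s \<xi>)
      = (if fst (noise_key m \<xi>) then snd (noise_key m \<xi>) else argsort m s)" for s \<xi>
    by (simp add: played_score_def noise_key_def)
  have "butlast (history m (Suc t) \<omega>) = history m t \<omega>" "last (history m (Suc t) \<omega>) = noise_key m (\<omega> t)" for \<omega>
    by (simp_all add: history_def)
  then show ?case
    by (intro exI[of _ "\<lambda>l. let w = W (butlast l); s = score d (X t) w;
          \<sigma> = (if fst (last l) then snd (last l) else argsort m s);
          z = estimator \<phi> m \<gamma> (X t) s \<sigma> (feedback (feedback_size \<phi>) \<sigma> (R t))
      in project d U (\<lambda>j. w j - \<eta> * z j)"]) (simp add: W played Let_def)
qed auto

section \<open>Online gradient descent with estimated gradients\<close>

locale rtop =
  fixes \<phi> :: surrogate and m d n T :: nat and RD U \<eta> \<gamma> :: real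
    and X :: "nat \<Rightarrow> nat \<Rightarrow> nat \<Rightarrow> real" and R :: "nat \<Rightarrow> nat \<Rightarrow> nat"
  assumes feedback_le: "feedback_size \<phi> \<le> m"
    and RD: "0 \<le> RD" and U: "0 < U" and \<eta>: "0 < \<eta>" and \<gamma>: "0 < \<gamma>" "\<gamma> \<le> 1"
    and adm: "admissible m d n RD T X R"
begin

abbreviation weight :: "(nat \<Rightarrow> noise) \<Rightarrow> nat \<Rightarrow> nat \<Rightarrow> real" where
  "weight \<equiv> rtop_weight \<phi> m d U \<eta> \<gamma> X R"

abbreviation run :: "(nat \<Rightarrow> noise) measure" where
  "run \<equiv> run_noise T m \<gamma>"

abbreviation score_loss :: "nat \<Rightarrow> (nat \<Rightarrow> real) \<Rightarrow> real" where
  "score_loss t w \<equiv> loss \<phi> m (score d (X t) w) (R t)"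

abbreviation smooth :: real where
  "smooth \<equiv> smooth_const \<phi> RD (real m)"

abbreviation var :: real where
  "var \<equiv> var_const \<phi> RD (real m) U (real n)"

abbreviation explore :: real where
  "explore \<equiv> explore_bound \<phi> RD (real m) U (real n)"

text \<open>The update as a function of the ranking instead of the noise, so that
  \<open>ranking_mean\<close> applies to it.\<close>

definition step :: "nat \<Rightarrow> (nat \<Rightarrow> real) \<Rightarrow> nat list \<Rightarrow> nat \<Rightarrow> real" where
  "step t w \<sigma> = project d U (\<lambda>j. w j - \<eta> *
     estimator \<phi> m \<gamma> (X t) (score d (X t) w) \<sigma> (feedback (feedback_size \<phi>) \<sigma> (R t)) j)"

text \<open>Losses at the algorithm's own scores, not at the played ones: descent controls these,
  and exploration is charged separately.\<close>

definition mean_loss :: real where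
  "mean_loss = (\<Sum>t<T. \<integral>\<omega>. score_loss t (weight \<omega> t) \<partial>run)"

lemma weight_Suc: "weight \<omega> (Suc t) = step t (weight \<omega> t) (argsort m (played_score (score d (X t) (weight \<omega> t)) (\<omega> t)))"
  by (simp add: step_def Let_def)

lemma L2_set_weight_le: "L2_set (weight \<omega> t) {..<d} \<le> U"
proof (cases t)
  case 0
  then show ?thesis using U by (simp add: L2_set_def)
next
  case (Suc k)
  show ?thesis unfolding Suc weight_Suc step_def using U by (intro L2_set_project_le) simp
qed

lemma row_le: "t < T \<Longrightarrow> i < m \<Longrightarrow> L2_set (X t i) {..<d} \<le> RD"
  and relevance_le: "t < T \<Longrightarrow> i < m \<Longrightarrow> R t i \<le> n"
  using adm by (auto simp: admissible_def)

lemma weight_average: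
  fixes G :: "(nat \<Rightarrow> real) \<Rightarrow> noise \<Rightarrow> real"
  assumes "t < T" "\<And>w. integrable (round_noise m \<gamma>) (G w)"
  shows "integrable run (\<lambda>\<omega>. G (weight \<omega> t) (\<omega> t))"
    and "(\<integral>\<omega>. G (weight \<omega> t) (\<omega> t) \<partial>run) = (\<integral>\<omega>. (\<integral>\<xi>. G (weight \<omega> t) \<xi> \<partial>round_noise m \<gamma>) \<partial>run)"
proof -
  obtain W where W: "\<And>\<omega>. weight \<omega> t = W (history m t \<omega>)"
    using rtop_weight_history by metis
  show "integrable run (\<lambda>\<omega>. G (weight \<omega> t) (\<omega> t))"
    "(\<integral>\<omega>. G (weight \<omega> t) (\<omega> t) \<partial>run) = (\<integral>\<omega>. (\<integral>\<xi>. G (weight \<omega> t) \<xi> \<partial>round_noise m \<gamma>) \<partial>run)"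
    unfolding W by (rule run_expectation[where G = "\<lambda>l. G (W l)"]; use assms in simp)+
qed

text \<open>\<open>f\<close> can be arbitrary because the weight takes finitely many values over all
  noises.\<close>

lemma weight_integrable:
  fixes f :: "(nat \<Rightarrow> real) \<Rightarrow> real"
  assumes "t \<le> T"
  shows "integrable run (\<lambda>\<omega>. f (weight \<omega> t))"
proof -
  obtain W where W: "\<And>\<omega>. weight \<omega> t = W (history m t \<omega>)"
    using rtop_weight_history by metis
  show ?thesis unfolding W using run_integrable[OF assms, where f = "\<lambda>l. f (W l)"] .
qed

text \<open>One step for a fixed current weight: the projection does not increase the distance to
  \<open>v\<close>, the linear term of the expanded square has the subgradient as its mean, and the
  quadratic term is the second moment.\<close>

lemma step_descent:
  assumes t: "t < T" and w: "L2_set w {..<d} \<le> U" and v: "L2_set v {..<d} \<le> U"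
  shows "ranking_mean m \<gamma> (argsort m (score d (X t) w)) (\<lambda>\<sigma>. \<Sum>j<d. (step t w \<sigma> j - v j)\<^sup>2)
    \<le> (\<Sum>j<d. (w j - v j)\<^sup>2)
      + (\<eta>\<^sup>2 * (smooth * score_loss t w + var / \<gamma>) - 2 * \<eta> * (score_loss t w - score_loss t v))"
proof -
  define s where "s = score d (X t) w"
  define s' where "s' = score d (X t) v"
  let ?dir = "est_dir \<phi> m \<gamma> s (R t)"
  let ?M = "ranking_mean m \<gamma> (argsort m s)"
  let ?z = "\<lambda>\<sigma>. backproj m (X t) (?dir \<sigma>)"
  have s_le: "s i \<le> RD * U" if "i < m" for i
  proof -
    have "s i \<le> RD * L2_set w {..<d}"
      using abs_score_le[of "X t", OF row_le[OF t that], of w] unfolding s_def by linarith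
    also have "\<dots> \<le> RD * U" using w RD by (rule mult_left_mono)
    finally show ?thesis .
  qed
  have "(\<Sum>j<d. (step t w \<sigma> j - v j)\<^sup>2) \<le> (\<Sum>j<d. (w j - v j)\<^sup>2)
      + ((- 2 * \<eta>) * (\<Sum>i<m. (s i - s' i) * ?dir \<sigma> i) + \<eta>\<^sup>2 * (L2_set (?z \<sigma>) {..<d})\<^sup>2)"
    if \<sigma>: "\<sigma> \<in> permutations_of_set {..<m}" for \<sigma>
  proof -
    have "(\<Sum>j<d. (step t w \<sigma> j - v j)\<^sup>2) \<le> (\<Sum>j<d. ((w j - \<eta> * ?z \<sigma> j) - v j)\<^sup>2)"
      unfolding step_def estimator_eq_backproj[OF \<sigma> feedback_le] s_def[symmetric]
      by (rule project_contracts[OF v])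
    also have "\<dots> = (\<Sum>j<d. (w j - v j)\<^sup>2 + (- 2 * \<eta> * (?z \<sigma> j * (w j - v j)) + \<eta>\<^sup>2 * (?z \<sigma> j)\<^sup>2))"
      by (intro sum.cong) (auto simp: power2_eq_square algebra_simps)
    also have "\<dots> = (\<Sum>j<d. (w j - v j)\<^sup>2)
        + ((- 2 * \<eta>) * (\<Sum>j<d. ?z \<sigma> j * (w j - v j)) + \<eta>\<^sup>2 * (\<Sum>j<d. (?z \<sigma> j)\<^sup>2))"
      by (simp only: sum.distrib sum_distrib_left)
    also have "(\<Sum>j<d. ?z \<sigma> j * (w j - v j)) = (\<Sum>i<m. (s i - s' i) * ?dir \<sigma> i)"
      unfolding sum_backproj_mult s_def s'_def by (simp add: mult.commute)
    finally show ?thesis by (simp add: L2_set_power2)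
  qed
  then have "?M (\<lambda>\<sigma>. \<Sum>j<d. (step t w \<sigma> j - v j)\<^sup>2) \<le> ?M (\<lambda>\<sigma>. (\<Sum>j<d. (w j - v j)\<^sup>2)
      + ((- 2 * \<eta>) * (\<Sum>i<m. (s i - s' i) * ?dir \<sigma> i) + \<eta>\<^sup>2 * (L2_set (?z \<sigma>) {..<d})\<^sup>2))"
    using \<gamma> by (intro ranking_mean_mono) auto
  also have "\<dots> = (\<Sum>j<d. (w j - v j)\<^sup>2) + ((- 2 * \<eta>) * (\<Sum>i<m. (s i - s' i) * ?M (\<lambda>\<sigma>. ?dir \<sigma> i))
      + \<eta>\<^sup>2 * ?M (\<lambda>\<sigma>. (L2_set (?z \<sigma>) {..<d})\<^sup>2))"
    by (simp only: ranking_mean_add ranking_mean_scale ranking_mean_sum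
        ranking_mean_const[OF argsort_permutation])
  also have "(\<Sum>i<m. (s i - s' i) * ?M (\<lambda>\<sigma>. ?dir \<sigma> i)) = (\<Sum>i<m. subgrad \<phi> m s (R t) i * (s i - s' i))"
    using \<gamma> feedback_le by (intro sum.cong) (auto simp: ranking_mean_est_dir)
  also have "(\<Sum>j<d. (w j - v j)\<^sup>2) + ((- 2 * \<eta>) * \<dots> + \<eta>\<^sup>2 * ?M (\<lambda>\<sigma>. (L2_set (?z \<sigma>) {..<d})\<^sup>2))
      \<le> (\<Sum>j<d. (w j - v j)\<^sup>2) + ((- 2 * \<eta>) * (loss \<phi> m s (R t) - loss \<phi> m s' (R t))
        + \<eta>\<^sup>2 * (smooth * loss \<phi> m s (R t) + var / \<gamma>))"
    using \<eta> \<gamma> feedback_le RD loss_diff_le_subgrad[of \<phi> m s "R t" s'] row_le[OF t] relevance_le[OF t] s_le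
    by (intro add_left_mono add_mono mult_left_mono_neg mult_left_mono estimator_second_moment) auto
  finally show ?thesis by (simp add: s_def s'_def)
qed

lemma expected_descent:
  assumes t: "t < T" and v: "L2_set v {..<d} \<le> U"
  shows "(\<integral>\<omega>. (\<Sum>j<d. (weight \<omega> (Suc t) j - v j)\<^sup>2) \<partial>run)
    \<le> (\<integral>\<omega>. (\<Sum>j<d. (weight \<omega> t j - v j)\<^sup>2) \<partial>run)
      + (\<eta>\<^sup>2 * (smooth * (\<integral>\<omega>. score_loss t (weight \<omega> t) \<partial>run) + var / \<gamma>)
        - 2 * \<eta> * ((\<integral>\<omega>. score_loss t (weight \<omega> t) \<partial>run) - score_loss t v))"
proof -
  interpret prob_space run by (rule prob_space_run_noise)
  let ?G = "\<lambda>w \<xi>. \<Sum>j<d. (step t w (argsort m (played_score (score d (X t) w) \<xi>)) j - v j)\<^sup>2"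
  let ?H = "\<lambda>w. (\<Sum>j<d. (w j - v j)\<^sup>2)
      + (\<eta>\<^sup>2 * (smooth * score_loss t w + var / \<gamma>) - 2 * \<eta> * (score_loss t w - score_loss t v))"
  have int: "integrable (round_noise m \<gamma>) (?G w)" for w
    using \<gamma> by (intro round_ranking_expectation(1)[where g = "\<lambda>\<sigma>. \<Sum>j<d. (step t w \<sigma> j - v j)\<^sup>2"]) auto
  have "(\<integral>\<omega>. (\<Sum>j<d. (weight \<omega> (Suc t) j - v j)\<^sup>2) \<partial>run) = (\<integral>\<omega>. ?G (weight \<omega> t) (\<omega> t) \<partial>run)"
    by (simp only: weight_Suc)
  also have "\<dots> = (\<integral>\<omega>. (\<integral>\<xi>. ?G (weight \<omega> t) \<xi> \<partial>round_noise m \<gamma>) \<partial>run)"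
    by (rule weight_average(2)[OF t int])
  also have "\<dots> \<le> (\<integral>\<omega>. ?H (weight \<omega> t) \<partial>run)"
  proof (rule integral_mono)
    show "integrable run (\<lambda>\<omega>. \<integral>\<xi>. ?G (weight \<omega> t) \<xi> \<partial>round_noise m \<gamma>)"
      using t by (intro weight_integrable[where f = "\<lambda>w. \<integral>\<xi>. ?G w \<xi> \<partial>round_noise m \<gamma>"]) simp
    show "integrable run (\<lambda>\<omega>. ?H (weight \<omega> t))"
      using t by (intro weight_integrable[where f = ?H]) simp
    fix \<omega>
    have "(\<integral>\<xi>. ?G (weight \<omega> t) \<xi> \<partial>round_noise m \<gamma>)
        = ranking_mean m \<gamma> (argsort m (score d (X t) (weight \<omega> t)))
          (\<lambda>\<sigma>. \<Sum>j<d. (step t (weight \<omega> t) \<sigma> j - v j)\<^sup>2)"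
      using \<gamma> by (intro round_ranking_expectation(2)[where g = "\<lambda>\<sigma>. \<Sum>j<d. (step t (weight \<omega> t) \<sigma> j - v j)\<^sup>2"]) auto
    also have "\<dots> \<le> ?H (weight \<omega> t)"
      by (rule step_descent[OF t L2_set_weight_le v])
    finally show "(\<integral>\<xi>. ?G (weight \<omega> t) \<xi> \<partial>round_noise m \<gamma>) \<le> ?H (weight \<omega> t)" .
  qed
  also have "\<dots> = (\<integral>\<omega>. (\<Sum>j<d. (weight \<omega> t j - v j)\<^sup>2) \<partial>run)
      + (\<eta>\<^sup>2 * (smooth * (\<integral>\<omega>. score_loss t (weight \<omega> t) \<partial>run) + var / \<gamma>)
        - 2 * \<eta> * ((\<integral>\<omega>. score_loss t (weight \<omega> t) \<partial>run) - score_loss t v))"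
  proof -
    have [simp]: "integrable run (\<lambda>\<omega>. score_loss t (weight \<omega> t))"
      using t by (intro weight_integrable) simp
    have [simp]: "integrable run (\<lambda>\<omega>. \<Sum>j<d. (weight \<omega> t j - v j)\<^sup>2)"
      using t by (intro weight_integrable[where f = "\<lambda>w. \<Sum>j<d. (w j - v j)\<^sup>2"]) simp
    show ?thesis by (simp add: prob_space)
  qed
  finally show ?thesis .
qed

text \<open>The potentials telescope from |v|^2, as the run starts at 0. The self-bounding term is
  moved to the left-hand side, and |v| is kept in place of U so that v = 0 costs nothing.\<close>

lemma mean_loss_le:
  assumes v: "L2_set v {..<d} \<le> U"
  shows "(2 - \<eta> * smooth) * mean_loss
    \<le> 2 * comparator_loss \<phi> m d X R T v + (L2_set v {..<d})\<^sup>2 / \<eta> + \<eta> * real T * var / \<gamma>"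
proof -
  interpret prob_space run by (rule prob_space_run_noise)
  let ?V = "\<lambda>t. \<integral>\<omega>. (\<Sum>j<d. (weight \<omega> t j - v j)\<^sup>2) \<partial>run"
  let ?L = "\<lambda>t. \<integral>\<omega>. score_loss t (weight \<omega> t) \<partial>run"
  have "?V T \<le> ?V 0 + (\<Sum>t<T. \<eta>\<^sup>2 * (smooth * ?L t + var / \<gamma>) - 2 * \<eta> * (?L t - score_loss t v))"
  proof -
    have "(\<Sum>t<T. ?V (Suc t) - ?V t)
        \<le> (\<Sum>t<T. \<eta>\<^sup>2 * (smooth * ?L t + var / \<gamma>) - 2 * \<eta> * (?L t - score_loss t v))"
      using expected_descent[OF _ v] by (intro sum_mono) (simp add: algebra_simps del: rtop_weight.simps)
    moreover have "(\<Sum>t<T. ?V (Suc t) - ?V t) = ?V T - ?V 0" by (rule sum_lessThan_telescope)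
    ultimately show ?thesis by linarith
  qed
  moreover have "0 \<le> ?V T" by (intro integral_nonneg_AE AE_I2 sum_nonneg) auto
  moreover have "?V 0 = (L2_set v {..<d})\<^sup>2" by (simp add: L2_set_power2 prob_space)
  moreover have "(\<Sum>t<T. \<eta>\<^sup>2 * (smooth * ?L t + var / \<gamma>) - 2 * \<eta> * (?L t - score_loss t v))
      = \<eta>\<^sup>2 * (smooth * mean_loss + real T * (var / \<gamma>)) - 2 * \<eta> * (mean_loss - comparator_loss \<phi> m d X R T v)"
    by (simp add: mean_loss_def comparator_loss_def sum_subtractf sum.distrib sum_distrib_left[symmetric])
  ultimately have "\<eta> * ((2 - \<eta> * smooth) * mean_loss)
      \<le> 2 * \<eta> * comparator_loss \<phi> m d X R T v + (L2_set v {..<d})\<^sup>2 + \<eta>\<^sup>2 * (real T * (var / \<gamma>))"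
    by (simp add: power2_eq_square algebra_simps)
  also have "\<dots> = \<eta> * (2 * comparator_loss \<phi> m d X R T v + (L2_set v {..<d})\<^sup>2 / \<eta> + \<eta> * real T * var / \<gamma>)"
    using \<eta> by (simp add: field_simps power2_eq_square)
  finally show ?thesis using \<eta> by (simp only: mult_le_cancel_left_pos)
qed

lemma rtop_loss_integrable: "integrable run (rtop_loss \<phi> m d U \<eta> \<gamma> X R T)"
  and rtop_loss_expectation_le:
    "(\<integral>\<omega>. rtop_loss \<phi> m d U \<eta> \<gamma> X R T \<omega> \<partial>run) \<le> mean_loss + \<gamma> * real T * explore"
proof -
  interpret prob_space run by (rule prob_space_run_noise)
  let ?G = "\<lambda>t w \<xi>. loss \<phi> m (played_score (score d (X t) w) \<xi>) (R t)"
  have G: "integrable (round_noise m \<gamma>) (?G t w)"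
    "(\<integral>\<xi>. ?G t w \<xi> \<partial>round_noise m \<gamma>) \<le> score_loss t w + \<gamma> * explore" if "t < T" for t w
    using \<gamma> RD U relevance_le[OF that] by (auto intro!: round_loss_expectation)
  note avg = weight_average[OF _ G(1)]
  have int: "t < T \<Longrightarrow> integrable run (\<lambda>\<omega>. ?G t (weight \<omega> t) (\<omega> t))" for t
    by (rule avg(1))
  then show "integrable run (rtop_loss \<phi> m d U \<eta> \<gamma> X R T)"
    unfolding rtop_loss_def[abs_def] by (intro Bochner_Integration.integrable_sum) auto
  have "(\<integral>\<omega>. ?G t (weight \<omega> t) (\<omega> t) \<partial>run) \<le> (\<integral>\<omega>. score_loss t (weight \<omega> t) \<partial>run) + \<gamma> * explore"
    if t: "t < T" for t
  proof -
    have "(\<integral>\<omega>. ?G t (weight \<omega> t) (\<omega> t) \<partial>run) = (\<integral>\<omega>. (\<integral>\<xi>. ?G t (weight \<omega> t) \<xi> \<partial>round_noise m \<gamma>) \<partial>run)"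
      using t by (intro avg(2)) auto
    also have "\<dots> \<le> (\<integral>\<omega>. score_loss t (weight \<omega> t) + \<gamma> * explore \<partial>run)"
      using t G(2)[OF t]
      by (intro integral_mono weight_integrable[where f = "\<lambda>w. \<integral>\<xi>. ?G t w \<xi> \<partial>round_noise m \<gamma>"]
          weight_integrable[where f = "\<lambda>w. score_loss t w + \<gamma> * explore"]) auto
    also have "\<dots> = (\<integral>\<omega>. score_loss t (weight \<omega> t) \<partial>run) + \<gamma> * explore"
      using t weight_integrable[of t "score_loss t"] by (simp add: prob_space)
    finally show ?thesis .
  qed
  then have "(\<Sum>t<T. \<integral>\<omega>. ?G t (weight \<omega> t) (\<omega> t) \<partial>run)
      \<le> (\<Sum>t<T. (\<integral>\<omega>. score_loss t (weight \<omega> t) \<partial>run) + \<gamma> * explore)"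
    by (intro sum_mono) auto
  also have "\<dots> = mean_loss + \<gamma> * real T * explore"
    by (simp add: mean_loss_def sum.distrib)
  finally show "(\<integral>\<omega>. rtop_loss \<phi> m d U \<eta> \<gamma> X R T \<omega> \<partial>run) \<le> mean_loss + \<gamma> * real T * explore"
    unfolding rtop_loss_def using int by (subst Bochner_Integration.integral_sum) auto
qed

text \<open>Division of \<open>mean_loss_le\<close> by 2 - x, where x = \<eta> A: for x in [0, 1],
  (2 - x) (1 + x) = 2 + x (1 - x) >= 2 and 2 - x >= 1.\<close>

lemma rtop_loss_le:
  assumes "\<eta> * smooth \<le> 1" and v: "L2_set v {..<d} \<le> U"
  shows "(\<integral>\<omega>. rtop_loss \<phi> m d U \<eta> \<gamma> X R T \<omega> \<partial>run)
    \<le> (1 + \<eta> * smooth) * comparator_loss \<phi> m d X R T v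
      + (L2_set v {..<d})\<^sup>2 / \<eta> + \<eta> * real T * var / \<gamma> + \<gamma> * real T * explore"
proof -
  define x where "x = \<eta> * smooth"
  define C where "C = comparator_loss \<phi> m d X R T v"
  define Q where "Q = (L2_set v {..<d})\<^sup>2 / \<eta> + \<eta> * real T * var / \<gamma>"
  have "0 \<le> smooth" using RD by (cases \<phi>) auto
  then have x: "0 \<le> x" "x \<le> 1" using assms \<eta> by (auto simp: x_def)
  have "0 \<le> C" by (auto simp: C_def comparator_loss_def intro!: sum_nonneg loss_nonneg)
  have "0 \<le> var" using RD by (cases \<phi>) auto
  then have "0 \<le> Q" using \<eta> \<gamma> by (auto simp: Q_def)
  have "(2 - x) * mean_loss \<le> 2 * C + Q"
    using mean_loss_le[OF v] by (simp add: x_def C_def Q_def)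
  also have "\<dots> \<le> (2 - x) * ((1 + x) * C + Q)"
  proof -
    have "(2 - x) * ((1 + x) * C + Q) - (2 * C + Q) = x * (1 - x) * C + (1 - x) * Q"
      by (simp add: algebra_simps)
    moreover have "0 \<le> x * (1 - x) * C + (1 - x) * Q" using x \<open>0 \<le> C\<close> \<open>0 \<le> Q\<close> by simp
    ultimately show ?thesis by linarith
  qed
  finally have "mean_loss \<le> (1 + x) * C + Q" using x by (simp only: mult_le_cancel_left_pos)
  then show ?thesis using rtop_loss_expectation_le by (simp add: x_def C_def Q_def)
qed

section \<open>Regret bounds for a fixed learning rate\<close>

lemma regret_leI:
  assumes "\<And>v. L2_set v {..<d} \<le> U
    \<Longrightarrow> (\<integral>\<omega>. rtop_loss \<phi> m d U \<eta> \<gamma> X R T \<omega> \<partial>run) \<le> comparator_loss \<phi> m d X R T v + b"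
  shows "regret \<phi> m d U \<eta> \<gamma> X R T \<le> b"
proof -
  have "(\<integral>\<omega>. rtop_loss \<phi> m d U \<eta> \<gamma> X R T \<omega> \<partial>run) - b
      \<le> (INF w\<in>{w. L2_set w {..<d} \<le> U}. comparator_loss \<phi> m d X R T w)"
  proof (rule cINF_greatest)
    have "(\<lambda>_. 0) \<in> {w. L2_set w {..<d} \<le> U}" using U by (simp add: L2_set_def)
    then show "{w. L2_set w {..<d} \<le> U} \<noteq> {}" by blast
    show "(\<integral>\<omega>. rtop_loss \<phi> m d U \<eta> \<gamma> X R T \<omega> \<partial>run) - b \<le> comparator_loss \<phi> m d X R T v"
      if "v \<in> {w. L2_set w {..<d} \<le> U}" for v
      using assms[of v] that by auto
  qed
  then show ?thesis by (simp add: regret_def)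
qed

lemma regret_le_of_no_smooth:
  assumes "smooth = 0"
  shows "regret \<phi> m d U \<eta> \<gamma> X R T \<le> U\<^sup>2 / \<eta> + \<eta> * real T * var / \<gamma> + \<gamma> * real T * explore"
proof (rule regret_leI)
  fix v assume v: "L2_set v {..<d} \<le> U"
  then have "(L2_set v {..<d})\<^sup>2 / \<eta> \<le> U\<^sup>2 / \<eta>"
    using \<eta> by (intro divide_right_mono power_mono) auto
  then show "(\<integral>\<omega>. rtop_loss \<phi> m d U \<eta> \<gamma> X R T \<omega> \<partial>run) \<le> comparator_loss \<phi> m d X R T v
      + (U\<^sup>2 / \<eta> + \<eta> * real T * var / \<gamma> + \<gamma> * real T * explore)"
    using rtop_loss_le[OF _ v] assms by simp
qed

lemma comparator_loss_zero_le:
  assumes "\<phi> = SQ"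
  shows "comparator_loss \<phi> m d X R T (\<lambda>_. 0) \<le> real T * (real m * (real n)\<^sup>2)"
proof -
  have "score_loss t (\<lambda>_. 0) \<le> real m * (real n)\<^sup>2" if t: "t < T" for t
  proof -
    have "(\<Sum>i<m. (real (R t i))\<^sup>2) \<le> (\<Sum>i<m. (real n)\<^sup>2)"
      using relevance_le[OF t] by (intro sum_mono power_mono) auto
    then show ?thesis by (simp add: assms loss_def L2_set_power2 score_def)
  qed
  then have "(\<Sum>t<T. score_loss t (\<lambda>_. 0)) \<le> (\<Sum>t<T. real m * (real n)\<^sup>2)"
    by (intro sum_mono) auto
  then show ?thesis by (simp add: comparator_loss_def)
qed

text \<open>The excess \<eta> A is multiplied by the loss of the comparator, which for a poor
  \<open>v\<close> depends on its scores. Replacing such a \<open>v\<close> by 0 only strengthens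
  the comparison and caps that loss by T m n^2.\<close>

lemma regret_le_smooth:
  assumes "\<phi> = SQ" "\<eta> * smooth \<le> 1"
  shows "regret \<phi> m d U \<eta> \<gamma> X R T
    \<le> \<eta> * smooth * (real T * (real m * (real n)\<^sup>2))
      + U\<^sup>2 / \<eta> + \<eta> * real T * var / \<gamma> + \<gamma> * real T * explore"
proof (rule regret_leI)
  fix v assume v: "L2_set v {..<d} \<le> U"
  let ?C = "comparator_loss \<phi> m d X R T"
  define v' where "v' = (if ?C v \<le> ?C (\<lambda>_. 0) then v else (\<lambda>_. 0))"
  have v': "L2_set v' {..<d} \<le> U" "?C v' \<le> ?C v" "?C v' \<le> ?C (\<lambda>_. 0)"
    using v U by (auto simp: v'_def L2_set_def)
  then have "(L2_set v' {..<d})\<^sup>2 / \<eta> \<le> U\<^sup>2 / \<eta>"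
    using \<eta> by (intro divide_right_mono power_mono) auto
  moreover have "0 \<le> \<eta> * smooth" using assms RD \<eta> by simp
  then have "\<eta> * smooth * ?C v' \<le> \<eta> * smooth * (real T * (real m * (real n)\<^sup>2))"
    using v'(3) comparator_loss_zero_le[OF assms(1)] by (intro mult_left_mono) linarith+
  moreover have "(1 + \<eta> * smooth) * ?C v' = ?C v' + \<eta> * smooth * ?C v'"
    by (simp add: algebra_simps)
  ultimately show "(\<integral>\<omega>. rtop_loss \<phi> m d U \<eta> \<gamma> X R T \<omega> \<partial>run) \<le> ?C v
      + (\<eta> * smooth * (real T * (real m * (real n)\<^sup>2))
        + U\<^sup>2 / \<eta> + \<eta> * real T * var / \<gamma> + \<gamma> * real T * explore)"
    using rtop_loss_le[OF assms(2) v'(1)] v'(2) by linarith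
qed

text \<open>The initial weight \<open>0\<close> has zero distance to itself, so comparing with it costs no \<open>1 / \<eta>\<close>;
  this gives a bound for arbitrarily small learning rates.\<close>

lemma regret_le_trivial:
  assumes "\<phi> = SQ" "\<eta> * smooth \<le> 1"
  shows "regret \<phi> m d U \<eta> \<gamma> X R T
    \<le> 2 * (real T * (real m * (real n)\<^sup>2)) + \<eta> * real T * var / \<gamma> + \<gamma> * real T * explore"
proof (rule regret_leI)
  fix v assume "L2_set v {..<d} \<le> U"
  let ?C = "comparator_loss \<phi> m d X R T"
  \<comment> \<open>The loss of \<open>v\<close> is nonnegative and is dropped, so a bound on the
    loss of the run is already a bound on the regret.\<close>
  have nonneg: "0 \<le> ?C w" for w
    by (auto simp: comparator_loss_def intro!: sum_nonneg loss_nonneg)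
  have "L2_set (\<lambda>_. 0) {..<d} \<le> U" using U by (simp add: L2_set_def)
  note rtop_loss_le[OF assms(2) this]
  moreover have "(1 + \<eta> * smooth) * ?C (\<lambda>_. 0) \<le> 2 * (real T * (real m * (real n)\<^sup>2))"
    using assms(2) comparator_loss_zero_le[OF assms(1)] nonneg by (intro mult_mono) auto
  moreover have "(L2_set (\<lambda>_. 0 :: real) {..<d})\<^sup>2 / \<eta> = 0" by (simp add: L2_set_def)
  ultimately show "(\<integral>\<omega>. rtop_loss \<phi> m d U \<eta> \<gamma> X R T \<omega> \<partial>run) \<le> ?C v
      + (2 * (real T * (real m * (real n)\<^sup>2)) + \<eta> * real T * var / \<gamma> + \<gamma> * real T * explore)"
    using nonneg[of v] by linarith
qed

end

section \<open>Tuning\<close>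

text \<open>The polynomial with all coefficients 1 dominates every monomial of admissible degree at
  once, so a single \<open>P\<close> absorbs all terms of the regret.\<close>

lemma monomial_le_poly4:
  assumes "0 \<le> x" "0 \<le> y" "0 \<le> u" "0 \<le> v" "i + j + k + l \<le> D"
  shows "x ^ i * y ^ j * u ^ k * v ^ l \<le> poly4 D (\<lambda>_ _ _ _. 1) x y u v"
proof -
  let ?f = "\<lambda>i j k l. x ^ i * y ^ j * u ^ k * v ^ l"
  have "?f i j k l \<le> (\<Sum>l\<le>D - i - j - k. ?f i j k l)"
    using assms by (intro member_le_sum) auto
  also have "\<dots> \<le> (\<Sum>k\<le>D - i - j. \<Sum>l\<le>D - i - j - k. ?f i j k l)"
    using assms by (intro member_le_sum[of k _ "\<lambda>k. \<Sum>l\<le>D - i - j - k. ?f i j k l"] sum_nonneg) auto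
  also have "\<dots> \<le> (\<Sum>j\<le>D - i. \<Sum>k\<le>D - i - j. \<Sum>l\<le>D - i - j - k. ?f i j k l)"
    using assms by (intro member_le_sum[of j _ "\<lambda>j. \<Sum>k\<le>D - i - j. \<Sum>l\<le>D - i - j - k. ?f i j k l"] sum_nonneg) auto
  also have "\<dots> \<le> (\<Sum>i\<le>D. \<Sum>j\<le>D - i. \<Sum>k\<le>D - i - j. \<Sum>l\<le>D - i - j - k. ?f i j k l)"
    using assms
    by (intro member_le_sum[of i _ "\<lambda>i. \<Sum>j\<le>D - i. \<Sum>k\<le>D - i - j. \<Sum>l\<le>D - i - j - k. ?f i j k l"] sum_nonneg) auto
  finally show ?thesis by (simp add: poly4_def)
qed

lemma poly4_const: "poly4 D (\<lambda>_ _ _ _. c) x y u v = c * poly4 D (\<lambda>_ _ _ _. 1) x y u v"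
  by (simp add: poly4_def sum_distrib_left mult.assoc)

text \<open>With \<open>S = T\<^bsup>1/3\<^esup>\<close> all the powers of \<open>T\<close> below are integral powers of \<open>S\<close>.\<close>

lemma cube_root_powers:
  fixes T :: nat
  assumes "0 < T"
  obtains S where "1 \<le> S" "real T = S^3" "real T powr (2/3) = S\<^sup>2"
    "real T powr (-2/3) = 1 / S\<^sup>2" "real T powr (-1/3) = 1 / S"
proof
  let ?S = "real T powr (1/3)"
  have T: "1 \<le> real T" using assms by simp
  show "1 \<le> ?S" using T by (simp add: ge_one_powr_ge_zero)
  show "real T = ?S^3" using T by (simp add: powr_power)
  show 2: "real T powr (2/3) = ?S\<^sup>2" using T by (simp add: powr_power)
  show "real T powr (-2/3) = 1 / ?S\<^sup>2" unfolding 2[symmetric] using T by (simp add: powr_minus_divide)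
  show "real T powr (-1/3) = 1 / ?S" using T by (simp add: powr_minus_divide)
qed

text \<open>\<open>\<eta>\<close> is chosen separately for each T because the fallback for small T
  uses another formula; the common \<open>a\<close> bounds all choices.\<close>

lemma tuned_regret:
  fixes m d n :: nat and RD U :: real
  assumes m: "feedback_size \<phi> \<le> m" and RD: "0 \<le> RD" and U: "0 < U"
  shows "\<exists>a. \<forall>T>0. \<exists>\<eta>>0. \<eta> \<le> a * real T powr (-2/3) \<and> (\<forall>X R. admissible m d n RD T X R \<longrightarrow>
      integrable (run_noise T m (real T powr (-1/3) / 4))
        (rtop_loss \<phi> m d U \<eta> (real T powr (-1/3) / 4) X R T) \<and>
      regret \<phi> m d U \<eta> (real T powr (-1/3) / 4) X R T
        \<le> poly4 4 (\<lambda>_ _ _ _. 200) RD (real m) U (real n) * (hidden_factor \<phi> RD U (real n) * real T powr (2/3)))"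
proof -
  have m1: "1 \<le> real m" using m by (cases \<phi>) auto
  define P where "P = poly4 4 (\<lambda>_ _ _ _. 1) RD (real m) U (real n)"
  have mono: "RD ^ i * real m ^ j * U ^ k * real n ^ l \<le> P" if "i + j + k + l \<le> 4" for i j k l
    unfolding P_def using that RD U by (intro monomial_le_poly4) auto
  define E where "E = exp (max (real n) (RD * U))"
  have E: "0 < E" by (simp add: E_def)
  \<comment> \<open>Up to a constant, \<open>q\<close> is the square root of the variance constant
    with RD and n raised by 1. With a = U / q both U^2 / \<eta> and \<eta> T B / \<gamma> are of
    order S^2.\<close>
  define q where "q = (case \<phi> of SQ \<Rightarrow> real m * (RD + 1) * (real n + 1)
    | SVM \<Rightarrow> (real m)\<^sup>2 * (RD + 1) | KL \<Rightarrow> real m * (RD + 1) * E)"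
  have q: "0 < q" using m1 RD E by (cases \<phi>) (auto simp: q_def intro!: mult_pos_pos add_nonneg_pos)
  define a where "a = U / q"
  have a: "0 < a" using U q by (simp add: a_def)
  define h where "h = hidden_factor \<phi> RD U (real n)"
  have "\<exists>\<eta>>0. \<eta> \<le> a * real T powr (-2/3) \<and> (\<forall>X R. admissible m d n RD T X R \<longrightarrow>
      integrable (run_noise T m (real T powr (-1/3) / 4))
        (rtop_loss \<phi> m d U \<eta> (real T powr (-1/3) / 4) X R T) \<and>
      regret \<phi> m d U \<eta> (real T powr (-1/3) / 4) X R T \<le> 200 * P * (h * real T powr (2/3)))"
    if T: "0 < T" for T
  proof -
    obtain S where S: "1 \<le> S" and T_S: "real T = S^3" "real T powr (2/3) = S\<^sup>2"
      "real T powr (-2/3) = 1 / S\<^sup>2" "real T powr (-1/3) = 1 / S"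
      using T by (rule cube_root_powers)
    \<comment> \<open>The factor 1/4 keeps \<gamma> below 1/2 even at T = 1.\<close>
    define \<gamma> where "\<gamma> = 1 / S / 4"
    have \<gamma>: "0 < \<gamma>" "\<gamma> \<le> 1" using S by (auto simp: \<gamma>_def divide_le_eq)
    define B where "B = var_const \<phi> RD (real m) U (real n)"
    define D where "D = explore_bound \<phi> RD (real m) U (real n)"
    have B: "0 \<le> B" using RD by (cases \<phi>) (auto simp: B_def)
    have D: "\<gamma> * real T * D = S\<^sup>2 * (D / 4)"
      using S by (simp add: \<gamma>_def T_S power2_eq_square power3_eq_cube)
    have var: "\<eta> * real T * B / \<gamma> = \<eta> * S^4 * (4 * B)" for \<eta>
      using S by (simp add: \<gamma>_def T_S power4_eq_xxxx power3_eq_cube)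
    have rtop: "rtop \<phi> m d n T RD U \<eta> \<gamma> X R" if "0 < \<eta>" "admissible m d n RD T X R" for \<eta> X R
      using that m RD U \<gamma> by unfold_locales auto
    let ?good = "\<lambda>\<eta>. 0 < \<eta> \<and> \<eta> \<le> a / S\<^sup>2 \<and> (\<forall>X R. admissible m d n RD T X R \<longrightarrow>
        regret \<phi> m d U \<eta> \<gamma> X R T \<le> 200 * P * (h * S\<^sup>2))"
    have large: "U\<^sup>2 / (a / S\<^sup>2) = S\<^sup>2 * (U * q)" "(a / S\<^sup>2) * real T * B / \<gamma> = S\<^sup>2 * (4 * a * B)"
    proof -
      show "U\<^sup>2 / (a / S\<^sup>2) = S\<^sup>2 * (U * q)"
        using U q by (simp add: a_def power2_eq_square)
      show "(a / S\<^sup>2) * real T * B / \<gamma> = S\<^sup>2 * (4 * a * B)"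
        unfolding var using S by (simp add: power2_eq_square power4_eq_xxxx)
    qed
    have goodI: "?good (a / S\<^sup>2)"
      if "x \<le> 200 * P * h" "\<And>X R. admissible m d n RD T X R \<Longrightarrow> regret \<phi> m d U (a / S\<^sup>2) \<gamma> X R T \<le> S\<^sup>2 * x" for x
    proof -
      have "S\<^sup>2 * x \<le> S\<^sup>2 * (200 * P * h)" using that(1) by (rule mult_left_mono) simp
      also have "\<dots> = 200 * P * (h * S\<^sup>2)" by simp
      finally have le: "S\<^sup>2 * x \<le> 200 * P * (h * S\<^sup>2)" .
      have "0 < a / S\<^sup>2" using a S by simp
      with order_trans[OF that(2) le] show ?thesis by blast
    qed
    have "\<exists>\<eta>. ?good \<eta>"
    \<comment> \<open>For RD = 0 the constant vanishes for SQ as well; the second conjunct sends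
      that case to the other branch.\<close>
    proof (cases "smooth_const \<phi> RD (real m) = 0 \<and> \<phi> \<noteq> SQ")
      case True
      have "U * q + 4 * a * B + D / 4 \<le> 200 * P * h"
      proof (cases \<phi>)
        case SQ
        with True show ?thesis by simp
      next
        case SVM
        have "a * B \<le> 4 * (RD * (real m)\<^sup>2 * U)"
        proof -
          have "a * B = 4 * (RD * (real m)\<^sup>2 * U) * (RD / (RD + 1))"
            using SVM m1 RD by (simp add: a_def q_def B_def power2_eq_square)
          also have "\<dots> \<le> 4 * (RD * (real m)\<^sup>2 * U)"
            using RD U by (intro mult_right_le_one_le) auto
          finally show ?thesis .
        qed
        moreover have "U * q = RD * (real m)\<^sup>2 * U + (real m)\<^sup>2 * U"
          using SVM by (simp add: q_def algebra_simps)
        moreover have "D / 4 = (real m)\<^sup>2 / 2" using SVM by (simp add: D_def)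
        moreover have "h = 1" using SVM by (simp add: h_def)
        moreover have "RD * (real m)\<^sup>2 * U \<le> P" "(real m)\<^sup>2 * U \<le> P" "(real m)\<^sup>2 \<le> P" "1 \<le> P"
          using mono[of 1 2 1 0] mono[of 0 2 1 0] mono[of 0 2 0 0] mono[of 0 0 0 0] by auto
        ultimately show ?thesis by simp
      next
        case KL
        \<comment> \<open>\<open>B\<close> contains the exponential squared and \<open>q\<close>
          contains it once, so it survives exactly once, matching
          \<open>hidden_factor\<close>.\<close>
        have "a * B \<le> RD * real m * U * E"
        proof -
          have "a * B = (RD * real m * U * E) * (RD / (RD + 1))"
            using KL m1 RD E by (simp add: a_def q_def B_def E_def[symmetric] power2_eq_square)
          also have "\<dots> \<le> RD * real m * U * E"
            using RD U E by (intro mult_right_le_one_le) auto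
          finally show ?thesis .
        qed
        moreover have "RD * real m * U * E \<le> P * E" "real m * U * E \<le> P * E"
          "real m * real n * E \<le> P * E" "real m * E \<le> P * E" "0 \<le> P * E"
          using mono[of 1 1 1 0] mono[of 0 1 1 0] mono[of 0 1 0 1] mono[of 0 1 0 0] mono[of 0 0 0 0] E
          by (auto intro!: mult_right_mono)
        moreover have "U * q = RD * real m * U * E + real m * U * E"
          using KL by (simp add: q_def algebra_simps)
        moreover have "D / 4 = (real m * real n * E) / 4 + 3 * (real m * E) / 4"
          using KL by (simp add: D_def E_def[symmetric] algebra_simps add_divide_distrib)
        moreover have "200 * P * h = 200 * (P * E)" using KL by (simp add: h_def E_def)
        ultimately show ?thesis by linarith
      qed
      moreover have "regret \<phi> m d U (a / S\<^sup>2) \<gamma> X R T \<le> S\<^sup>2 * (U * q + 4 * a * B + D / 4)"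
        if "admissible m d n RD T X R" for X R
      proof -
        have "0 < a / S\<^sup>2" using a S by simp
        from rtop.regret_le_of_no_smooth[OF rtop[OF this that]] True
        show ?thesis unfolding B_def[symmetric] D_def[symmetric] large D distrib_left by blast
      qed
      ultimately have "?good (a / S\<^sup>2)" by (rule goodI)
      then show ?thesis by blast
    next
      case False
      then have SQ: "\<phi> = SQ" by (cases \<phi>) auto
      define A where "A = smooth_const \<phi> RD (real m)"
      have A: "0 \<le> A" using RD by (simp add: A_def SQ)
      have h: "h = 1" by (simp add: h_def SQ)
      have D': "D / 4 = real m * (real n)\<^sup>2 / 4 + real m / 4" by (simp add: D_def SQ algebra_simps add_divide_distrib)
      have P: "RD * real m * U * real n \<le> P" "RD * real m * U \<le> P" "real m * U * real n \<le> P"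
        "real m * U \<le> P" "real m * (real n)\<^sup>2 \<le> P" "real m \<le> P" "1 \<le> P"
        using mono[of 1 1 1 1] mono[of 1 1 1 0] mono[of 0 1 1 1] mono[of 0 1 1 0] mono[of 0 1 0 2]
          mono[of 0 1 0 0] mono[of 0 0 0 0] by auto
      have frac: "RD / (RD + 1) \<le> 1" "real n / (real n + 1) \<le> 1" "0 \<le> RD / (RD + 1)" "0 \<le> real n / (real n + 1)"
        using RD by auto
      show ?thesis
      proof (cases "(a / S\<^sup>2) * A \<le> 1")
        case True
        have aB: "a * ((real m)\<^sup>2 * RD\<^sup>2 * (real n)\<^sup>2) \<le> RD * real m * U * real n"
        proof -
          have "a * ((real m)\<^sup>2 * RD\<^sup>2 * (real n)\<^sup>2)
              = (RD * real m * U * real n) * ((RD / (RD + 1)) * (real n / (real n + 1)))"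
            using SQ m1 RD by (simp add: a_def q_def power2_eq_square)
          also have "\<dots> \<le> RD * real m * U * real n"
            using RD U frac by (intro mult_right_le_one_le mult_le_one mult_nonneg_nonneg) auto
          finally show ?thesis .
        qed
        \<comment> \<open>The self-bounding term is only of order S, and its constant is a multiple
          of the quantity bounded in \<open>aB\<close>.\<close>
        have "(a / S\<^sup>2) * A * (real T * (real m * (real n)\<^sup>2)) = S * (8 * (a * ((real m)\<^sup>2 * RD\<^sup>2 * (real n)\<^sup>2)))"
          using S by (simp add: A_def SQ T_S power2_eq_square power3_eq_cube)
        also have "\<dots> \<le> S\<^sup>2 * (8 * (RD * real m * U * real n))"
        proof (rule mult_mono)
          show "S \<le> S\<^sup>2" using S by (simp add: power2_eq_square)
          show "8 * (a * ((real m)\<^sup>2 * RD\<^sup>2 * (real n)\<^sup>2)) \<le> 8 * (RD * real m * U * real n)"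
            using aB by linarith
        qed (use a in auto)
        finally have 1: "(a / S\<^sup>2) * A * (real T * (real m * (real n)\<^sup>2)) \<le> S\<^sup>2 * (8 * (RD * real m * U * real n))" .
        \<comment> \<open>In total 8 + 4 + 128 + 1/2 copies of \<open>P\<close>, the largest count
          among all cases; 200 is a round number above it.\<close>
        have "8 * (RD * real m * U * real n) + U * q + 4 * a * B + D / 4 \<le> 200 * P * h"
        proof -
          have "4 * a * B = 128 * (a * ((real m)\<^sup>2 * RD\<^sup>2 * (real n)\<^sup>2))"
            by (simp add: B_def SQ power_mult_distrib)
          moreover have "U * q = RD * real m * U * real n + RD * real m * U + real m * U * real n + real m * U"
            by (simp add: q_def SQ algebra_simps)
          ultimately show ?thesis unfolding h using aB P D' by linarith
        qed
        moreover have "regret \<phi> m d U (a / S\<^sup>2) \<gamma> X R T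
            \<le> S\<^sup>2 * (8 * (RD * real m * U * real n) + U * q + 4 * a * B + D / 4)"
          if "admissible m d n RD T X R" for X R
          using rtop.regret_le_smooth[OF rtop[OF _ that] SQ, of "a / S\<^sup>2"] True a S large D 1
          unfolding A_def[symmetric] B_def[symmetric] D_def[symmetric] distrib_left by simp
        ultimately have "?good (a / S\<^sup>2)" by (rule goodI)
        then show ?thesis by blast
      next
        case False
        \<comment> \<open>Each summand of the denominator serves one purpose: 1 makes it positive,
          \<open>A\<close> gives \<eta> A <= 1, and the last makes the whole variance term at most
          1.\<close>
        define \<eta> where "\<eta> = 1 / (1 + A + S^4 * (4 * B))"
        have den: "0 < 1 + A + S^4 * (4 * B)" using A B S by (intro add_pos_nonneg) auto
        have \<eta>: "0 < \<eta>" "\<eta> * A \<le> 1" "\<eta> * S^4 * (4 * B) \<le> 1"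
          using den A B S by (auto simp: \<eta>_def divide_le_eq)
        have Apos: "0 < A" using False A a by (cases "A = 0") auto
        have "\<eta> \<le> 1 / A" using \<eta>(2) Apos by (simp add: pos_le_divide_eq)
        \<comment> \<open>The failed case test says exactly this, so the tiny rate still obeys the
          common bound with \<open>a\<close>.\<close>
        also have "1 / A \<le> a / S\<^sup>2" using False Apos by (simp add: pos_divide_le_eq)
        finally have le: "\<eta> \<le> a / S\<^sup>2" .
        have "S\<^sup>2 < a * A" using False S by (simp add: divide_simps)
        also have "a * A = 8 * (U * RD * (RD / (RD + 1)) / (real n + 1))"
          using m1 RD by (simp add: a_def q_def A_def SQ power2_eq_square)
        also have "\<dots> \<le> 8 * (U * RD * 1 / (real n + 1))"
          using RD U frac by (intro mult_left_mono divide_right_mono) auto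
        finally have S2: "S\<^sup>2 \<le> 8 * (U * RD / (real n + 1))" by simp
        \<comment> \<open>T = S^3, so one surplus factor S must be absorbed. The bound
          \<open>S2\<close> expresses it by U RD / (n + 1), and the division by n + 1 lowers n^2 to
          n, which leaves the degree-four monomial RD m U n.\<close>
        have "S \<le> 1 + S\<^sup>2" using S by (simp add: power2_eq_square add_increasing mult_left_le)
        also have "\<dots> \<le> 1 + 8 * (U * RD / (real n + 1))" using S2 by simp
        finally have "S * (real m * (real n)\<^sup>2) \<le> (1 + 8 * (U * RD / (real n + 1))) * (real m * (real n)\<^sup>2)"
          by (intro mult_right_mono) auto
        also have "\<dots> = real m * (real n)\<^sup>2 + 8 * (RD * real m * U * real n) * (real n / (real n + 1))"
          by (simp add: algebra_simps power2_eq_square)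
        also have "\<dots> \<le> real m * (real n)\<^sup>2 + 8 * (RD * real m * U * real n)"
          using RD U frac by (intro add_left_mono mult_right_le_one_le) auto
        finally have 1: "S * (real m * (real n)\<^sup>2) \<le> 9 * P" using P by linarith
        have "2 * (real T * (real m * (real n)\<^sup>2)) = S\<^sup>2 * (2 * (S * (real m * (real n)\<^sup>2)))"
          by (simp add: T_S power2_eq_square power3_eq_cube)
        also have "\<dots> \<le> S\<^sup>2 * (18 * P)" using 1 by (intro mult_left_mono) auto
        finally have 2: "2 * (real T * (real m * (real n)\<^sup>2)) \<le> S\<^sup>2 * (18 * P)" .
        have "1 * 1 \<le> S\<^sup>2 * P" using S P by (intro mult_mono one_le_power) auto
        then have 3: "\<eta> * real T * B / \<gamma> \<le> S\<^sup>2 * P" using \<eta>(3) unfolding var by linarith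
        have 4: "\<gamma> * real T * D \<le> S\<^sup>2 * P"
          unfolding D using D' P by (intro mult_left_mono) auto
        have 5: "0 \<le> S\<^sup>2 * P" using P by (intro mult_nonneg_nonneg) auto
        have "regret \<phi> m d U \<eta> \<gamma> X R T \<le> 200 * P * (h * S\<^sup>2)" if "admissible m d n RD T X R" for X R
        proof -
          have "regret \<phi> m d U \<eta> \<gamma> X R T \<le> 20 * (S\<^sup>2 * P)"
          proof -
            have "regret \<phi> m d U \<eta> \<gamma> X R T
                \<le> 2 * (real T * (real m * (real n)\<^sup>2)) + \<eta> * real T * B / \<gamma> + \<gamma> * real T * D"
              using rtop.regret_le_trivial[OF rtop[OF \<eta>(1) that] SQ] \<eta>(2)
              unfolding A_def B_def D_def by blast
            also have "\<dots> \<le> S\<^sup>2 * (18 * P) + S\<^sup>2 * P + S\<^sup>2 * P"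
              using 2 3 4 by (intro add_mono)
            finally show ?thesis by (simp add: mult_ac)
          qed
          also have "\<dots> \<le> 200 * (S\<^sup>2 * P)" using 5 by linarith
          finally show ?thesis by (simp add: h mult_ac)
        qed
        with \<eta>(1) le show ?thesis by blast
      qed
    qed
    then obtain \<eta> where "?good \<eta>" ..
    then show ?thesis
      using rtop.rtop_loss_integrable[OF rtop] unfolding T_S(2-4) \<gamma>_def[symmetric] by (intro exI[of _ \<eta>]) auto
  qed
  then show ?thesis unfolding poly4_const[of _ 200] P_def[symmetric] h_def[symmetric] by blast
qed

theorem theorem4p1:
  fixes \<phi> :: surrogate
  shows "\<exists>(c :: nat \<Rightarrow> nat \<Rightarrow> nat \<Rightarrow> nat \<Rightarrow> real) (g :: nat \<Rightarrow> real).
    g \<in> O(\<lambda>T. real T powr (2/3)) \<and>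
    (\<forall>(m::nat) (d::nat) (n::nat) (RD::real) (U::real).
       feedback_size \<phi> \<le> m \<and> 0 \<le> RD \<and> 0 < U \<longrightarrow>
       (\<exists>(\<eta> :: nat \<Rightarrow> real) (\<gamma> :: nat \<Rightarrow> real).
          \<eta> \<in> O(\<lambda>T. real T powr (-2/3)) \<and>
          \<gamma> \<in> O(\<lambda>T. real T powr (-1/3)) \<and>
          (\<forall>T>0. 0 < \<eta> T \<and> 0 < \<gamma> T \<and> \<gamma> T < 1/2) \<and>
          (\<forall>T>0. \<forall>X R. admissible m d n RD T X R \<longrightarrow>
             integrable (run_noise T m (\<gamma> T)) (rtop_loss \<phi> m d U (\<eta> T) (\<gamma> T) X R T) \<and>
             regret \<phi> m d U (\<eta> T) (\<gamma> T) X R T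
               \<le> poly4 4 c RD (real m) U (real n) * (hidden_factor \<phi> RD U (real n) * g T))))"
proof (rule exI[of _ "\<lambda>_ _ _ _. 200"], rule exI[of _ "\<lambda>T. real T powr (2/3)"], intro conjI allI impI)
  fix m d n :: nat and RD U :: real
  assume *: "feedback_size \<phi> \<le> m \<and> 0 \<le> RD \<and> 0 < U"
  let ?\<gamma> = "\<lambda>T. real T powr (-1/3) / 4"
  let ?good = "\<lambda>a T \<eta>. 0 < \<eta> \<and> \<eta> \<le> a * real T powr (-2/3) \<and> (\<forall>X R. admissible m d n RD T X R \<longrightarrow>
      integrable (run_noise T m (?\<gamma> T)) (rtop_loss \<phi> m d U \<eta> (?\<gamma> T) X R T) \<and>
      regret \<phi> m d U \<eta> (?\<gamma> T) X R T
        \<le> poly4 4 (\<lambda>_ _ _ _. 200) RD (real m) U (real n) * (hidden_factor \<phi> RD U (real n) * real T powr (2/3)))"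
  obtain a where "\<forall>T>0. \<exists>\<eta>. ?good a T \<eta>" using tuned_regret[of \<phi> m RD U d n] * by auto
  then obtain \<eta> where \<eta>: "\<And>T. T > 0 \<Longrightarrow> ?good a T (\<eta> T)" by metis
  have \<eta>_bigo: "\<eta> \<in> O(\<lambda>T. real T powr (-2/3))"
  proof (rule bigoI[of _ a])
    show "\<forall>\<^sub>F T in sequentially. norm (\<eta> T) \<le> a * norm (real T powr (-2/3))"
      \<comment> \<open>The value of \<open>\<eta>\<close> at T = 0 is unspecified, so the estimate
        starts at T = 1.\<close>
      using eventually_gt_at_top[of 0]
    proof (rule eventually_mono)
      fix T :: nat assume "0 < T"
      then have "0 < \<eta> T" "\<eta> T \<le> a * real T powr (-2/3)" using \<eta>[of T] by blast+
      then show "norm (\<eta> T) \<le> a * norm (real T powr (-2/3))" by simp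
    qed
  qed
  have \<gamma>_bigo: "?\<gamma> \<in> O(\<lambda>T. real T powr (-1/3))"
    by (rule bigoI[of _ 1]) auto
  have "0 < ?\<gamma> T \<and> ?\<gamma> T < 1/2" if T: "T > 0" for T :: nat
  proof -
    obtain S where S: "1 \<le> S" "real T powr (-1/3) = 1 / S" using T by (rule cube_root_powers)
    then have "0 < 1 / S" "1 / S \<le> 1" by auto
    then show ?thesis unfolding S(2) by simp
  qed
  then have range: "\<forall>T>0. 0 < \<eta> T \<and> 0 < ?\<gamma> T \<and> ?\<gamma> T < 1/2" using \<eta> by blast
  have bound: "\<forall>T>0. \<forall>X R. admissible m d n RD T X R \<longrightarrow>
      integrable (run_noise T m (?\<gamma> T)) (rtop_loss \<phi> m d U (\<eta> T) (?\<gamma> T) X R T) \<and>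
      regret \<phi> m d U (\<eta> T) (?\<gamma> T) X R T
        \<le> poly4 4 (\<lambda>_ _ _ _. 200) RD (real m) U (real n)
          * (hidden_factor \<phi> RD U (real n) * real T powr (2/3))"
    using \<eta> by blast
  show "\<exists>(\<eta> :: nat \<Rightarrow> real) (\<gamma> :: nat \<Rightarrow> real).
          \<eta> \<in> O(\<lambda>T. real T powr (-2/3)) \<and>
          \<gamma> \<in> O(\<lambda>T. real T powr (-1/3)) \<and>
          (\<forall>T>0. 0 < \<eta> T \<and> 0 < \<gamma> T \<and> \<gamma> T < 1/2) \<and>
          (\<forall>T>0. \<forall>X R. admissible m d n RD T X R \<longrightarrow>
             integrable (run_noise T m (\<gamma> T)) (rtop_loss \<phi> m d U (\<eta> T) (\<gamma> T) X R T) \<and>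
             regret \<phi> m d U (\<eta> T) (\<gamma> T) X R T
               \<le> poly4 4 (\<lambda>_ _ _ _. 200) RD (real m) U (real n)
                 * (hidden_factor \<phi> RD U (real n) * real T powr (2/3)))"
    by (intro exI[of _ \<eta>] exI[of _ ?\<gamma>] conjI \<eta>_bigo \<gamma>_bigo range bound)
qed simp

end
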